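(* Assume that $\eta_\Pi<\rho_\Pi$. Then, as $k\to\infty$, $$F^\Pi(k)=c_\Pi^{\mathrm{top}}(w^\star)\,\rho_\Pi^{\,k-1}+O\!\left(\frac{\rho_\Pi^{\,k-1}}{k}+\eta_\Pi^{\,k-1}\right),$$ where the implied constant does not depend on $k$.
   Context: A task is a pair $(X,y)$ with $X\in\mathbb R^{n\times d}$, $y\in\mathbb R^n$ ($n\ge1$ may depend on the task) and $\operatorname{rank}(X)<d$. $\Pi$ is a probability distribution on tasks. Common-solution assumption: there is a fixed vector $w^\star\in\mathbb R^d$ with $y=Xw^\star$ for every task under consideration. Tasks $(X_1,y_1),(X_2,y_2),\dots$ are i.i.d. from $\Pi$, with $X_t\in\mathbb R^{n_t\times d}$. Write $X^+$ for the Moore–Penrose pseudoinverse and set $$P_t:=I-X_t^+X_t,\qquad C_t:=\tfrac1{n_t}X_t^\top X_t,\qquad X_\star:=w^\star w^{\star\top};$$ $P_t$ is the orthogonal projector onto $\operatorname{null}(X_t)$. Exact-fit iterates: $w_0=0$ and, for $t\ge1$, $w_t:=\arg\min\{\tfrac12\|w-w_{t-1}\|_2^2:\ w\in\mathbb R^d,\ X_tw=y_t\}$; equivalently $w_t=w_{t-1}+X_t^+(y_t-X_tw_{t-1})=w^\star+P_t(w_{t-1}-w^\star)$. Forgetting: $\ell_t(w):=\tfrac1{n_t}\|X_tw-y_t\|_2^2$ and $F^\Pi(k):=\mathbb E\big[\tfrac1k\sum_{t=1}^k\ell_t(w_k)\big]$. All expectations appearing are assumed finite; in particular $\mathbb E\|C_t\|_F<\infty$.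 Spectral objects: $\mathbb S^d$ is the space of symmetric $d\times d$ real matrices with the Frobenius inner product; $S_\Pi:\mathbb S^d\to\mathbb S^d$, $S_\Pi(A):=\mathbb E[P_tAP_t]$ (independent of $t$); $\rho_\Pi:=\|S_\Pi\|_{\mathrm{op},F}$ is the operator norm of $S_\Pi$ with respect to the Frobenius norm; $\mathcal E_\Pi:=\{Y\in\mathbb S^d:S_\Pi(Y)=\rho_\Pi Y\}$; $\mathcal Q_\Pi:\mathbb S^d\to\mathcal E_\Pi$ is the Frobenius-orthogonal projector onto $\mathcal E_\Pi$; $\eta_\Pi:=\|S_\Pi|_{\mathcal E_\Pi^\perp}\|_{\mathrm{op},F}$ (equal to $0$ if $\mathcal E_\Pi^\perp=\{0\}$); and $$c_\Pi^{\mathrm{top}}(w^\star):=\mathbb E\,\operatorname{tr}\!\big(\mathcal Q_\Pi(C_t)\,P_t\,\mathcal Q_\Pi(X_\star)\,P_t\big).$$ *)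

theory Defs
  imports "HOL-Probability.Probability" "HOL-Library.Landau_Symbols"
begin

text \<open>
  The ambient dimension d is the cardinality of the index type, so vectors have type
  \<^typ>\<open>real ^ 'd\<close> and square matrices \<^typ>\<open>real ^ 'd ^ 'd\<close>.  On the latter the library's
  \<^const>\<open>norm\<close> and \<^const>\<open>inner\<close> are the Frobenius norm and the Frobenius inner product.

  The number n of rows varies from task to task, so a matrix with n rows is given by n together
  with a family of rows \<^typ>\<open>nat \<Rightarrow> real ^ 'd\<close>, of which only the indices below n are
  meaningful: the entry (i, j) is \<open>X i $ j\<close>, and the i-th entry of the product of X with w is
  \<open>X i \<bullet> w\<close>.  A task is the triple (n, X, y).
\<close>

type_synonym 'd task = "nat \<times> (nat \<Rightarrow> real ^ 'd) \<times> (nat \<Rightarrow> real)"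

abbreviation task_n :: "'d task \<Rightarrow> nat" where "task_n \<tau> \<equiv> fst \<tau>"
abbreviation task_X :: "'d task \<Rightarrow> nat \<Rightarrow> real ^ 'd" where "task_X \<tau> \<equiv> fst (snd \<tau>)"
abbreviation task_y :: "'d task \<Rightarrow> nat \<Rightarrow> real" where "task_y \<tau> \<equiv> snd (snd \<tau>)"

text \<open>
  Padding by zeros beyond index n makes the triples correspond bijectively to pairs (X, y).
  As for the library's \<open>rank\<close>, the rank is the dimension of the span of the rows.
\<close>

definition tasks :: "('d::finite) task set" where
  "tasks = {\<tau>. task_n \<tau> \<ge> 1 \<and> dim (task_X \<tau> ` {..<task_n \<tau>}) < CARD('d) \<and>
     (\<forall>i\<ge>task_n \<tau>. task_X \<tau> i = 0 \<and> task_y \<tau> i = 0)}"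

text \<open>
  For each fixed n, the sigma-algebra below is the Borel sigma-algebra on the pairs (X, y) with
  n rows.
\<close>

definition task_space :: "('d::finite) task measure" where
  "task_space = restrict_space
     (count_space UNIV \<Otimes>\<^sub>M ((\<Pi>\<^sub>M i\<in>UNIV. borel) \<Otimes>\<^sub>M (\<Pi>\<^sub>M i\<in>UNIV. borel))) tasks"

definition solves :: "('d::finite) task \<Rightarrow> real ^ 'd \<Rightarrow> bool" where
  "solves \<tau> w \<longleftrightarrow> (\<forall>i<task_n \<tau>. task_X \<tau> i \<bullet> w = task_y \<tau> i)"

text \<open>
  The four Penrose equations for X with n rows and Y with n columns.  Here \<open>Y k\<close> is the k-th
  \<^emph>\<open>column\<close> of Y, so that \<open>X i \<bullet> Y k\<close> is the entry (i, k) of the product X Y.  In order, the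
  equations are X Y X = X (read row by row), Y X Y = Y (read column by column), and the symmetry
  of X Y and of Y X.  The last clause only fixes the unused values of Y.
\<close>

definition is_pseudoinverse ::
    "nat \<Rightarrow> (nat \<Rightarrow> real ^ 'd::finite) \<Rightarrow> (nat \<Rightarrow> real ^ 'd) \<Rightarrow> bool" where
  "is_pseudoinverse n X Y \<longleftrightarrow>
     (\<forall>i<n. (\<Sum>k<n. (X i \<bullet> Y k) *\<^sub>R X k) = X i) \<and>
     (\<forall>k<n. (\<Sum>i<n. (X i \<bullet> Y k) *\<^sub>R Y i) = Y k) \<and>
     (\<forall>i<n. \<forall>k<n. X i \<bullet> Y k = X k \<bullet> Y i) \<and>
     (\<forall>a b. (\<Sum>i<n. Y i $ a * X i $ b) = (\<Sum>i<n. Y i $ b * X i $ a)) \<and>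
     (\<forall>k\<ge>n. Y k = 0)"

definition pseudoinverse :: "nat \<Rightarrow> (nat \<Rightarrow> real ^ 'd::finite) \<Rightarrow> nat \<Rightarrow> real ^ 'd" where
  "pseudoinverse n X = (THE Y. is_pseudoinverse n X Y)"

definition task_P :: "('d::finite) task \<Rightarrow> real ^ 'd ^ 'd" where
  "task_P \<tau> = mat 1 -
     (\<chi> a b. \<Sum>i<task_n \<tau>. pseudoinverse (task_n \<tau>) (task_X \<tau>) i $ a * task_X \<tau> i $ b)"

definition task_C :: "('d::finite) task \<Rightarrow> real ^ 'd ^ 'd" where
  "task_C \<tau> = (1 / real (task_n \<tau>)) *\<^sub>R
     (\<chi> a b. \<Sum>i<task_n \<tau>. task_X \<tau> i $ a * task_X \<tau> i $ b)"

definition outer_self :: "real ^ 'd::finite \<Rightarrow> real ^ 'd ^ 'd" where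
  "outer_self w = (\<chi> a b. w $ a * w $ b)"

text \<open>Task sequences are indexed from 1; the value at index 0 is never used.\<close>

primrec iterate :: "(nat \<Rightarrow> ('d::finite) task) \<Rightarrow> nat \<Rightarrow> real ^ 'd" where
  "iterate \<tau> 0 = 0"
| "iterate \<tau> (Suc t) =
     arg_min (\<lambda>w. 1 / 2 * (norm (w - iterate \<tau> t))\<^sup>2) (\<lambda>w. solves (\<tau> (Suc t)) w)"

definition task_loss :: "('d::finite) task \<Rightarrow> real ^ 'd \<Rightarrow> real" where
  "task_loss \<tau> w =
     1 / real (task_n \<tau>) * (L2_set (\<lambda>i. task_X \<tau> i \<bullet> w - task_y \<tau> i) {..<task_n \<tau>})\<^sup>2"

definition forgetting :: "'w measure \<Rightarrow> (nat \<Rightarrow> 'w \<Rightarrow> ('d::finite) task) \<Rightarrow> nat \<Rightarrow> real" where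
  "forgetting M T k =
     (\<integral>\<omega>. 1 / real k * (\<Sum>t=1..k. task_loss (T t \<omega>) (iterate (\<lambda>s. T s \<omega>) k)) \<partial>M)"

definition sym_mats :: "(real ^ 'd ^ 'd::finite) set" where
  "sym_mats = {A. transpose A = A}"

text \<open>\<^const>\<open>onorm\<close> relativised to a subspace; it is 0 on the zero subspace.\<close>

definition onorm_on :: "'a::real_normed_vector set \<Rightarrow> ('a \<Rightarrow> 'b::real_normed_vector) \<Rightarrow> real" where
  "onorm_on V f = (SUP x\<in>V. norm (f x) / norm x)"

text \<open>The operator S is only of interest on \<^const>\<open>sym_mats\<close>.\<close>

definition S_op :: "('d::finite) task measure \<Rightarrow> real ^ 'd ^ 'd \<Rightarrow> real ^ 'd ^ 'd" where
  "S_op D A = (\<integral>\<tau>. task_P \<tau> ** A ** task_P \<tau> \<partial>D)"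

definition rho :: "('d::finite) task measure \<Rightarrow> real" where
  "rho D = onorm_on sym_mats (S_op D)"

definition top_eigenspace :: "('d::finite) task measure \<Rightarrow> (real ^ 'd ^ 'd) set" where
  "top_eigenspace D = {Y \<in> sym_mats. S_op D Y = rho D *\<^sub>R Y}"

definition top_proj :: "('d::finite) task measure \<Rightarrow> real ^ 'd ^ 'd \<Rightarrow> real ^ 'd ^ 'd" where
  "top_proj D A =
     (THE Z. Z \<in> top_eigenspace D \<and> (\<forall>Y\<in>top_eigenspace D. orthogonal (A - Z) Y))"

definition eta :: "('d::finite) task measure \<Rightarrow> real" where
  "eta D = onorm_on {A \<in> sym_mats. \<forall>Y\<in>top_eigenspace D. orthogonal A Y} (S_op D)"

definition c_top :: "('d::finite) task measure \<Rightarrow> real ^ 'd \<Rightarrow> real" where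
  "c_top D w = (\<integral>\<tau>. trace (top_proj D (task_C \<tau>) ** task_P \<tau> **
      top_proj D (outer_self w) ** task_P \<tau>) \<partial>D)"

end

theory Submission
  imports Defs
begin

text \<open>
  The error \<open>e\<^sub>k = w\<^sub>k - w\<^sup>\<star>\<close> satisfies \<open>e\<^sub>k = P\<^sub>k \<dots> P\<^sub>1 e\<^sub>0\<close>, so the loss on task \<open>t\<close> is the Frobenius
  product of \<open>C\<^sub>t\<close> with \<open>P\<^sub>k \<dots> P\<^sub>1 X\<^sub>\<star> P\<^sub>1 \<dots> P\<^sub>k\<close>.  By independence and self-adjointness of \<open>S\<close>, its
  expectation is \<open>E \<langle>S\<^bsup>k-t\<^esup> C, P S\<^bsup>t-1\<^esup>(X\<^sub>\<star>) P\<rangle>\<close>.  Since \<open>S\<^bsup>m\<^esup> A = \<rho>\<^bsup>m\<^esup> Q A + O(\<eta>\<^bsup>m\<^esup> \<parallel>A\<parallel>)\<close> on symmetric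
  matrices, this is \<open>c \<rho>\<^bsup>k-1\<^esup>\<close> up to \<open>O(\<eta>\<^bsup>k-t\<^esup> \<rho>\<^bsup>t-1\<^esup> + \<rho>\<^bsup>k-t\<^esup> \<eta>\<^bsup>t-1\<^esup>)\<close>, and these errors sum over \<open>t\<close> to
  \<open>O(\<rho>\<^bsup>k-1\<^esup>)\<close>.

  The projector \<open>P\<close> and the exact-fit step are limits of gradient descent iterations, which gives their
  measurability as functions of the task.
\<close>

subsection \<open>The pseudoinverse and the null-space projector\<close>

definition row_null :: "nat \<Rightarrow> (nat \<Rightarrow> real ^ 'd::finite) \<Rightarrow> (real ^ 'd) set" where
  "row_null n X = {v. \<forall>i<n. X i \<bullet> v = 0}"

text \<open>The map \<open>z \<mapsto> X^T X z\<close>.\<close>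

definition gram_map :: "nat \<Rightarrow> (nat \<Rightarrow> real ^ 'd::finite) \<Rightarrow> real ^ 'd \<Rightarrow> real ^ 'd" where
  "gram_map n X z = (\<Sum>i<n. (X i \<bullet> z) *\<^sub>R X i)"

lemma linear_gram_map: "linear (gram_map n X)"
  by (rule linearI)
     (simp_all add: gram_map_def inner_add_right scaleR_add_left sum.distrib scaleR_sum_right)

lemma inner_gram_map: "z \<bullet> gram_map n X z = (\<Sum>i<n. (X i \<bullet> z)\<^sup>2)"
  by (simp add: gram_map_def inner_sum_right power2_eq_square inner_commute)

lemma gram_map_eq_0_iff: "gram_map n X z = 0 \<longleftrightarrow> z \<in> row_null n X"
proof
  assume "gram_map n X z = 0"
  then have "(\<Sum>i<n. (X i \<bullet> z)\<^sup>2) = 0"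
    by (metis inner_gram_map inner_zero_right)
  then show "z \<in> row_null n X"
    by (simp add: sum_nonneg_eq_0_iff row_null_def)
qed (simp add: gram_map_def row_null_def)

text \<open>\<open>X^T X\<close> maps the complement of its kernel into itself and is injective
  there, because a vector lying both in the kernel and in its complement is \<open>0\<close>.
  Equality of dimensions then gives surjectivity.\<close>

lemma gram_map_surj_on_orthogonal_comp:
  assumes "u \<in> (row_null n X)\<^sup>\<bottom>"
  obtains z where "z \<in> (row_null n X)\<^sup>\<bottom>" "gram_map n X z = u"
proof -
  let ?V = "(row_null n X)\<^sup>\<bottom>" and ?G = "gram_map n X"
  have V: "subspace ?V"
    by (rule subspace_orthogonal_comp)
  have sub: "?G ` ?V \<subseteq> ?V"
    by (auto simp: orthogonal_comp_def row_null_def gram_map_def orthogonal_def inner_sum_right inner_commute)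
  have "inj_on ?G (span ?V)"
  proof (rule inj_onI)
    fix x y assume xy: "x \<in> span ?V" "y \<in> span ?V" "?G x = ?G y"
    then have mem: "x - y \<in> ?V"
      using V by (metis span_eq_iff subspace_diff)
    have "?G (x - y) = 0"
      using xy linear_diff[OF linear_gram_map] by (metis right_minus_eq)
    then have "x - y \<in> row_null n X"
      by (simp add: gram_map_eq_0_iff)
    with mem have "(x - y) \<bullet> (x - y) = 0"
      by (auto simp: orthogonal_comp_def orthogonal_def)
    then show "x = y" by simp
  qed
  then have "dim (?G ` ?V) = dim ?V"
    by (rule dim_image_eq[OF linear_gram_map])
  then have "?G ` ?V = ?V"
    using sub V by (intro subspace_dim_equal linear_subspace_image[OF linear_gram_map]) auto
  then have "u \<in> ?G ` ?V"
    using assms by simp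
  then show thesis
    using that by (metis imageE)
qed

text \<open>Column \<open>k\<close> is taken to be the solution of \<open>X^T X z = X k\<close> in
  the orthogonal complement of the null space, so that \<open>Y\<close> inverts \<open>X^T X\<close>
  on this complement after \<open>X^T\<close> has been applied.\<close>

lemma is_pseudoinverse_exists: "\<exists>Y. is_pseudoinverse n X Y"
proof -
  let ?V = "(row_null n X)\<^sup>\<bottom>"
  have VD: "z \<bullet> v = 0" if "z \<in> ?V" "\<And>i. i < n \<Longrightarrow> X i \<bullet> v = 0" for z v
    using that by (auto simp: orthogonal_comp_def row_null_def orthogonal_def inner_commute)
  have V: "subspace ?V"
    by (rule subspace_orthogonal_comp)
  have "X k \<in> ?V" if "k < n" for k
    using that by (auto simp: orthogonal_comp_def row_null_def orthogonal_def inner_commute)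
  then have "\<exists>z. z \<in> ?V \<and> gram_map n X z = X k" if "k < n" for k
    using gram_map_surj_on_orthogonal_comp[of "X k"] that by metis
  then obtain Z where Z: "\<And>k. k < n \<Longrightarrow> Z k \<in> ?V" "\<And>k. k < n \<Longrightarrow> gram_map n X (Z k) = X k"
    by metis
  define Y where "Y k = (if k < n then Z k else 0)" for k
  have YV: "Y k \<in> ?V" for k
    using Z(1) V by (auto simp: Y_def subspace_0)
  have YX: "(\<Sum>i<n. (X i \<bullet> Y k) *\<^sub>R X i) = X k" if "k < n" for k
    using Z(2)[OF that] that by (simp add: Y_def gram_map_def)
  have sym: "X i \<bullet> Y k = X k \<bullet> Y i" if "i < n" "k < n" for i k
  proof -
    \<comment> \<open>In matrix form \<open>X Y = (X Y)^T (X Y)\<close>, whose right side is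
      symmetric.\<close>
    have *: "X i \<bullet> Y k = (\<Sum>j<n. (X j \<bullet> Y i) * (X j \<bullet> Y k))" if "i < n" for i k
      by (subst (1) YX[OF that, symmetric]) (simp add: inner_sum_left)
    show ?thesis
      unfolding *[OF \<open>i < n\<close>] *[OF \<open>k < n\<close>] by (simp add: mult.commute)
  qed
  have p1: "(\<Sum>k<n. (X i \<bullet> Y k) *\<^sub>R X k) = X i" if "i < n" for i
  proof -
    have "(\<Sum>k<n. (X i \<bullet> Y k) *\<^sub>R X k) = (\<Sum>k<n. (X k \<bullet> Y i) *\<^sub>R X k)"
      by (rule sum.cong) (simp_all add: sym[OF that])
    then show ?thesis by (simp only: YX[OF that])
  qed
  \<comment> \<open>\<open>K\<close> is the product \<open>Y X\<close>. Its values lie in the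
    complement of the null space and \<open>X K = X\<close>, so \<open>v - K v\<close> is a null
    vector: \<open>K\<close> is the orthogonal projector onto that complement. Hence it fixes every
    \<open>Y k\<close> and is symmetric, which are the two remaining Penrose equations.\<close>
  define K where "K v = (\<Sum>i<n. (X i \<bullet> v) *\<^sub>R Y i)" for v
  have KV: "K v \<in> ?V" for v
    unfolding K_def by (intro subspace_sum V subspace_scale YV)
  have XK: "X j \<bullet> K v = X j \<bullet> v" if "j < n" for j v
  proof -
    have "X j \<bullet> K v = (\<Sum>k<n. (X j \<bullet> Y k) *\<^sub>R X k) \<bullet> v"
      by (simp add: K_def inner_sum_right inner_sum_left mult.commute)
    then show ?thesis by (simp only: p1[OF that])
  qed
  have p2: "(\<Sum>i<n. (X i \<bullet> Y k) *\<^sub>R Y i) = Y k" for k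
  proof -
    have "(Y k - K (Y k)) \<bullet> (Y k - K (Y k)) = 0"
      by (rule VD[OF subspace_diff[OF V YV KV]]) (simp add: XK inner_diff_right)
    then show ?thesis by (simp add: K_def)
  qed
  have Ksym: "K v \<bullet> w = v \<bullet> K w" for v w
  proof -
    have "K v \<bullet> (w - K w) = 0" "K w \<bullet> (v - K v) = 0"
      by (rule VD[OF KV], simp add: XK inner_diff_right)+
    then show ?thesis by (simp add: inner_diff_right inner_commute)
  qed
  have p4: "(\<Sum>i<n. Y i $ a * X i $ b) = (\<Sum>i<n. Y i $ b * X i $ a)" for a b
    using Ksym[of "axis b 1" "axis a 1"]
    by (simp add: K_def inner_axis inner_axis' mult.commute)
  have "is_pseudoinverse n X Y"
    unfolding is_pseudoinverse_def 
    by (intro conjI allI impI p1 p2 sym p4) (simp_all add: Y_def)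
  then show ?thesis by blast
qed

text \<open>By \<open>Y X Y = Y\<close> and the symmetry of \<open>Y X\<close>, the product
  \<open>Y k \<bullet> v\<close> equals \<open>Y k \<bullet> (Y X v)\<close>, and
  \<open>X v = 0\<close>.\<close>

lemma is_pseudoinverse_orthogonal_row_null:
  fixes X Y :: "nat \<Rightarrow> real ^ 'd::finite"
  assumes "is_pseudoinverse n X Y" "v \<in> row_null n X"
  shows "Y k \<bullet> v = 0"
proof (cases "k < n")
  case True
  have sym: "(\<Sum>i<n. Y i $ a * X i $ b) = (\<Sum>i<n. Y i $ b * X i $ a)" for a b
    using assms by (simp add: is_pseudoinverse_def)
  \<comment> \<open>The bilinear form of \<open>Y X\<close> is written through its entries, so that
    their symmetry allows \<open>v\<close> and \<open>w\<close> to be exchanged.\<close>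
  have comp: "(\<Sum>i<n. (X i \<bullet> w) * (Y i \<bullet> v)) = (\<Sum>a\<in>UNIV. \<Sum>b\<in>UNIV. (\<Sum>i<n. Y i $ a * X i $ b) * (v $ a * w $ b))"
    for v w :: "real ^ 'd"
  proof -
    have "(\<Sum>i<n. (X i \<bullet> w) * (Y i \<bullet> v)) = (\<Sum>i<n. \<Sum>a\<in>UNIV. \<Sum>b\<in>UNIV. (Y i $ a * X i $ b) * (v $ a * w $ b))"
      unfolding inner_vec_def
      by (intro sum.cong refl, simp only: sum_product, subst sum.swap) (simp add: mult_ac)
    also have "\<dots> = (\<Sum>a\<in>UNIV. \<Sum>i<n. \<Sum>b\<in>UNIV. (Y i $ a * X i $ b) * (v $ a * w $ b))"
      by (rule sum.swap)
    also have "\<dots> = (\<Sum>a\<in>UNIV. \<Sum>b\<in>UNIV. \<Sum>i<n. (Y i $ a * X i $ b) * (v $ a * w $ b))"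
      by (intro sum.cong refl sum.swap)
    finally show ?thesis by (simp add: sum_distrib_right)
  qed
  have "Y k \<bullet> v = (\<Sum>i<n. (X i \<bullet> Y k) *\<^sub>R Y i) \<bullet> v"
    using assms True by (simp add: is_pseudoinverse_def)
  also have "\<dots> = (\<Sum>i<n. (X i \<bullet> Y k) * (Y i \<bullet> v))"
    by (simp add: inner_sum_left)
  also have "\<dots> = (\<Sum>i<n. (X i \<bullet> v) * (Y i \<bullet> Y k))"
    unfolding comp
    by (subst sum.swap, intro sum.cong refl, subst sym) (simp add: mult_ac)
  also have "\<dots> = 0"
    using assms by (simp add: row_null_def)
  finally show ?thesis .
qed (use assms in \<open>simp add: is_pseudoinverse_def\<close>)

text \<open>The symmetry of \<open>X Y\<close> together with \<open>X Y X = X\<close> gives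
  \<open>X^T X (Y k) = X k\<close>. So two candidates differ, column by column, by a null vector,
  while each column is orthogonal to the null space.\<close>

lemma is_pseudoinverse_unique:
  assumes Y: "is_pseudoinverse n X Y" and Z: "is_pseudoinverse n X Z"
  shows "Y = Z"
proof
  fix k
  show "Y k = Z k"
  proof (cases "k < n")
    case True
    have *: "gram_map n X (Y k) = X k" if "is_pseudoinverse n X Y" for Y
    proof -
      have "gram_map n X (Y k) = (\<Sum>i<n. (X k \<bullet> Y i) *\<^sub>R X i)"
        unfolding gram_map_def
        by (rule sum.cong) (use that True in \<open>auto simp: is_pseudoinverse_def\<close>)
      also have "\<dots> = X k"
        using that True unfolding is_pseudoinverse_def by blast
      finally show ?thesis .
    qed
    have "gram_map n X (Y k - Z k) = 0"
      using linear_diff[OF linear_gram_map] * Y Z by (metis right_minus_eq)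
    then have "Y k - Z k \<in> row_null n X"
      by (simp add: gram_map_eq_0_iff)
    then have "Y k \<bullet> (Y k - Z k) = 0" "Z k \<bullet> (Y k - Z k) = 0"
      using Y Z is_pseudoinverse_orthogonal_row_null by blast+
    then have "(Y k - Z k) \<bullet> (Y k - Z k) = 0"
      by (simp add: inner_diff_left)
    then show ?thesis by simp
  qed (use assms in \<open>simp add: is_pseudoinverse_def\<close>)
qed

lemma is_pseudoinverse_pseudoinverse: "is_pseudoinverse n X (pseudoinverse n X)"
  unfolding pseudoinverse_def
  by (rule theI'[OF ex_ex1I[OF is_pseudoinverse_exists is_pseudoinverse_unique]])

section \<open>The orthogonal projector onto the null space of a task\<close>

abbreviation task_null :: "('d::finite) task \<Rightarrow> (real ^ 'd) set" where
  "task_null \<tau> \<equiv> row_null (task_n \<tau>) (task_X \<tau>)"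

lemma task_P_apply:
  "task_P \<tau> *v v = v - (\<Sum>i<task_n \<tau>. (task_X \<tau> i \<bullet> v) *\<^sub>R pseudoinverse (task_n \<tau>) (task_X \<tau>) i)"
proof -
  have "(\<Sum>b\<in>UNIV. (\<Sum>i<task_n \<tau>. pseudoinverse (task_n \<tau>) (task_X \<tau>) i $ a * task_X \<tau> i $ b) * v $ b)
     = (\<Sum>i<task_n \<tau>. (task_X \<tau> i \<bullet> v) * pseudoinverse (task_n \<tau>) (task_X \<tau>) i $ a)" for a
    unfolding sum_distrib_right
    by (subst sum.swap) (simp add: inner_vec_def sum_distrib_left mult_ac)
  then have *: "(\<chi> a b. \<Sum>i<task_n \<tau>. pseudoinverse (task_n \<tau>) (task_X \<tau>) i $ a * task_X \<tau> i $ b) *v v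
     = (\<Sum>i<task_n \<tau>. (task_X \<tau> i \<bullet> v) *\<^sub>R pseudoinverse (task_n \<tau>) (task_X \<tau>) i)"
    by (simp add: vec_eq_iff matrix_vector_mult_def)
  then show ?thesis
    by (simp add: task_P_def matrix_vector_mult_diff_rdistrib *)
qed

lemma transpose_task_P [simp]: "transpose (task_P \<tau>) = task_P \<tau>"
  using is_pseudoinverse_pseudoinverse[of "task_n \<tau>" "task_X \<tau>"]
  by (simp add: vec_eq_iff task_P_def transpose_def is_pseudoinverse_def mat_def)

lemma inner_task_P: "(task_P \<tau> *v v) \<bullet> w = v \<bullet> (task_P \<tau> *v w)"
  by (metis dot_lmul_matrix transpose_matrix_vector transpose_task_P)

lemma task_P_in_null: "task_P \<tau> *v v \<in> task_null \<tau>"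
proof -
  have "task_X \<tau> j \<bullet> (task_P \<tau> *v v) = 0" if "j < task_n \<tau>" for j
  proof -
    let ?Y = "pseudoinverse (task_n \<tau>) (task_X \<tau>)"
    have "(\<Sum>k<task_n \<tau>. (task_X \<tau> j \<bullet> ?Y k) *\<^sub>R task_X \<tau> k) = task_X \<tau> j"
      using is_pseudoinverse_pseudoinverse[of "task_n \<tau>" "task_X \<tau>"] that
      unfolding is_pseudoinverse_def by blast
    then have "task_X \<tau> j \<bullet> v = (\<Sum>k<task_n \<tau>. (task_X \<tau> j \<bullet> ?Y k) * (task_X \<tau> k \<bullet> v))"
      by (metis (mono_tags, lifting) inner_scaleR_left inner_sum_left sum.cong)
    then show ?thesis
      by (simp add: task_P_apply inner_diff_right inner_sum_right mult.commute)
  qed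
  then show ?thesis by (simp add: row_null_def)
qed

lemma task_P_fixes_null: "v \<in> task_null \<tau> \<Longrightarrow> task_P \<tau> *v v = v"
  by (simp add: task_P_apply row_null_def)

lemma inner_null_task_P:
  assumes "v \<in> task_null \<tau>"
  shows "v \<bullet> (w - task_P \<tau> *v w) = 0"
  using inner_task_P[of \<tau> v w] assms by (simp add: task_P_fixes_null inner_diff_right)

lemma norm_task_P_le: "norm (task_P \<tau> *v v) \<le> norm v"
proof -
  have "norm (task_P \<tau> *v v) ^ 2 \<le> norm (task_P \<tau> *v v) * norm v"
    using inner_null_task_P[OF task_P_in_null, of \<tau> v v] norm_cauchy_schwarz[of "task_P \<tau> *v v" v]
    by (simp add: inner_diff_right power2_norm_eq_inner)
  then show ?thesis
    by (metis mult_left_le_imp_le norm_ge_zero order_le_less power2_eq_square)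
qed

lemma task_P_nth: "task_P \<tau> $ a $ b = (task_P \<tau> *v axis b 1) $ a"
  by (simp add: matrix_vector_mul_component inner_axis)

lemma abs_task_P_le_1: "\<bar>task_P \<tau> $ a $ b\<bar> \<le> 1"
proof -
  have "\<bar>(task_P \<tau> *v axis b 1) $ a\<bar> \<le> norm (task_P \<tau> *v axis b 1)"
    by (rule component_le_norm_cart)
  also have "\<dots> \<le> norm (axis b (1::real))" by (rule norm_task_P_le)
  finally show ?thesis by (simp add: task_P_nth)
qed

section \<open>The matrix C, and the exact-fit step as a projection\<close>

lemma task_C_apply: "task_C \<tau> *v v = (1 / real (task_n \<tau>)) *\<^sub>R gram_map (task_n \<tau>) (task_X \<tau>) v"
proof -
  have "(\<Sum>b\<in>UNIV. (\<Sum>i<task_n \<tau>. task_X \<tau> i $ a * task_X \<tau> i $ b) * v $ b)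
     = (\<Sum>i<task_n \<tau>. (task_X \<tau> i \<bullet> v) * task_X \<tau> i $ a)" for a
    unfolding sum_distrib_right
    by (subst sum.swap) (simp add: inner_vec_def sum_distrib_left mult_ac)
  then show ?thesis
    by (simp add: vec_eq_iff task_C_def gram_map_def matrix_vector_mult_def sum_divide_distrib[symmetric])
qed

lemma inner_task_C: "v \<bullet> (task_C \<tau> *v v) = (\<Sum>i<task_n \<tau>. (task_X \<tau> i \<bullet> v)\<^sup>2) / real (task_n \<tau>)"
  by (simp add: task_C_apply inner_gram_map)

lemma transpose_task_C [simp]: "transpose (task_C \<tau>) = task_C \<tau>"
  by (simp add: vec_eq_iff task_C_def transpose_def mult.commute)

lemma trace_task_C: "trace (task_C \<tau>) = (\<Sum>i<task_n \<tau>. (norm (task_X \<tau> i))\<^sup>2) / real (task_n \<tau>)"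
proof -
  have "(\<Sum>a\<in>UNIV. \<Sum>i<task_n \<tau>. task_X \<tau> i $ a * task_X \<tau> i $ a) = (\<Sum>i<task_n \<tau>. (norm (task_X \<tau> i))\<^sup>2)"
    by (subst sum.swap) (simp add: power2_norm_eq_inner inner_vec_def)
  then show ?thesis
    by (simp add: trace_def task_C_def sum_divide_distrib[symmetric])
qed

lemma trace_task_C_nonneg: "trace (task_C \<tau>) \<ge> 0"
  unfolding trace_task_C by (intro divide_nonneg_nonneg sum_nonneg) auto

text \<open>Cauchy-Schwarz over the rows. This is what makes the step size
  \<open>1 / (1 + trace C)\<close> small enough for a gradient step not to increase the
  norm.\<close>

lemma norm_task_C_apply_le: "(norm (task_C \<tau> *v v))\<^sup>2 \<le> trace (task_C \<tau>) * (v \<bullet> (task_C \<tau> *v v))"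
proof -
  let ?n = "task_n \<tau>" and ?X = "task_X \<tau>"
  have "norm (gram_map ?n ?X v) \<le> (\<Sum>i<?n. \<bar>?X i \<bullet> v\<bar> * \<bar>norm (?X i)\<bar>)"
    unfolding gram_map_def by (rule order.trans[OF norm_sum]) simp
  also have "\<dots> \<le> L2_set (\<lambda>i. ?X i \<bullet> v) {..<?n} * L2_set (\<lambda>i. norm (?X i)) {..<?n}"
    by (rule L2_set_mult_ineq)
  finally have "(norm (gram_map ?n ?X v))\<^sup>2 \<le> (L2_set (\<lambda>i. ?X i \<bullet> v) {..<?n} * L2_set (\<lambda>i. norm (?X i)) {..<?n})\<^sup>2"
    by (rule power_mono) simp
  also have "\<dots> = (\<Sum>i<?n. (?X i \<bullet> v)\<^sup>2) * (\<Sum>i<?n. (norm (?X i))\<^sup>2)"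
    by (simp add: L2_set_def power_mult_distrib sum_nonneg)
  finally show ?thesis
    unfolding inner_task_C trace_task_C unfolding task_C_apply
    by (simp add: power_divide power2_eq_square divide_right_mono mult.commute)
qed

text \<open>Gradient descent for \<open>v \<bullet> C v / 2\<close>. The summand \<open>1\<close>
  keeps the denominator positive even if \<open>X = 0\<close>, and the trace is a bound on the
  largest eigenvalue of \<open>C\<close> that is visibly measurable.\<close>

primrec landweber :: "('d::finite) task \<Rightarrow> real ^ 'd \<Rightarrow> nat \<Rightarrow> real ^ 'd" where
  "landweber \<tau> v 0 = v"
| "landweber \<tau> v (Suc m) =
     landweber \<tau> v m - (1 / (1 + trace (task_C \<tau>))) *\<^sub>R (task_C \<tau> *v landweber \<tau> v m)"

text \<open>The solutions form a translate of the null space. The point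
  \<open>w + P (iterate x t - w)\<close> is one of them, and Pythagoras shows that every other
  solution is strictly further from \<open>iterate x t\<close>.\<close>

lemma iterate_Suc:
  assumes "solves (x (Suc t)) w"
  shows "iterate x (Suc t) - w = task_P (x (Suc t)) *v (iterate x t - w)"
proof -
  let ?\<tau> = "x (Suc t)" and ?e = "iterate x t - w"
  define p where "p = w + task_P ?\<tau> *v ?e"
  have solves_iff: "solves ?\<tau> v \<longleftrightarrow> v - w \<in> task_null ?\<tau>" for v
    using assms by (auto simp: solves_def row_null_def inner_diff_right)
  have p: "solves ?\<tau> p"
    by (simp add: solves_iff p_def task_P_in_null)
  have pyth: "(norm (v - iterate x t))\<^sup>2 = (norm (v - p))\<^sup>2 + (norm (p - iterate x t))\<^sup>2" if "solves ?\<tau> v" for v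
  proof -
    have "v - p \<in> task_null ?\<tau>"
      using that p by (auto simp: solves_def row_null_def inner_diff_right)
    then have "(v - p) \<bullet> (?e - task_P ?\<tau> *v ?e) = 0"
      by (rule inner_null_task_P)
    also have "?e - task_P ?\<tau> *v ?e = - (p - iterate x t)"
      by (simp add: p_def)
    finally have "orthogonal (v - p) (p - iterate x t)"
      by (simp add: orthogonal_def inner_minus_right del: minus_diff_eq)
    then show ?thesis
      using norm_add_Pythagorean[of "v - p" "p - iterate x t"] by simp
  qed
  have "iterate x (Suc t) = p"
  proof -
    have min: "1 / 2 * (norm (p - iterate x t))\<^sup>2 \<le> 1 / 2 * (norm (v - iterate x t))\<^sup>2" if "solves ?\<tau> v" for v
      using pyth[OF that] by simp
    have "is_arg_min (\<lambda>w. 1 / 2 * (norm (w - iterate x t))\<^sup>2) (\<lambda>w. solves ?\<tau> w) p"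
      using min p by (auto simp: is_arg_min_linorder)
    \<comment> \<open>\<open>arg_min\<close> chooses some minimiser, so the existence of one makes
      the chosen value a minimiser; \<open>pyth\<close> then forces it to equal
      \<open>p\<close>.\<close>
    then have "is_arg_min (\<lambda>w. 1 / 2 * (norm (w - iterate x t))\<^sup>2) (\<lambda>w. solves ?\<tau> w) (iterate x (Suc t))"
      by (simp add: arg_min_def) (rule someI)
    then have "solves ?\<tau> (iterate x (Suc t))"
      "(norm (iterate x (Suc t) - iterate x t))\<^sup>2 \<le> (norm (p - iterate x t))\<^sup>2"
      using p unfolding is_arg_min_linorder by force+
    with pyth[of "iterate x (Suc t)"] have "(norm (iterate x (Suc t) - p))\<^sup>2 \<le> 0"
      by simp
    then show ?thesis by simp
  qed
  then show ?thesis by (simp add: p_def)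
qed

text \<open>
  On \<open>task_null\<close> the iteration is constant; on its complement the squared norm decreases by at least a
  multiple of \<open>v \<bullet> C v\<close>, which forces \<open>X v\<close>, and hence \<open>v = X\<^sup>+ X v\<close>, to tend to \<open>0\<close>.
\<close>

lemma landweber_tendsto_task_P: "landweber \<tau> v \<longlonglongrightarrow> task_P \<tau> *v v"
proof -
  let ?n = "task_n \<tau>" and ?X = "task_X \<tau>" and ?Y = "pseudoinverse (task_n \<tau>) (task_X \<tau>)"
  define c where "c = 1 / (1 + trace (task_C \<tau>))"
  have c: "c > 0" "c * trace (task_C \<tau>) \<le> 1"
    using trace_task_C_nonneg[of \<tau>] by (auto simp: c_def divide_simps)
  define u where "u m = landweber \<tau> v m - task_P \<tau> *v v" for m
  have u_Suc: "u (Suc m) = u m - c *\<^sub>R (task_C \<tau> *v u m)" for m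
  proof -
    have "task_C \<tau> *v (task_P \<tau> *v v) = 0"
      using task_P_in_null[of \<tau> v] by (simp add: task_C_apply gram_map_eq_0_iff)
    then show ?thesis
      by (simp add: u_def c_def matrix_vector_mult_diff_distrib)
  qed
  have Pu: "task_P \<tau> *v u m = 0" for m
  proof (induction m)
    case 0
    then show ?case
      by (simp add: u_def matrix_vector_mult_diff_distrib task_P_fixes_null task_P_in_null)
  next
    case (Suc m)
    have "task_P \<tau> *v (task_C \<tau> *v w) = 0" for w
    proof -
      let ?p = "task_P \<tau> *v (task_C \<tau> *v w)"
      have "?p \<bullet> ?p = (task_P \<tau> *v ?p) \<bullet> (task_C \<tau> *v w)"
        by (metis inner_commute inner_task_P)
      also have "\<dots> = ?p \<bullet> (task_C \<tau> *v w)"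
        by (simp add: task_P_fixes_null task_P_in_null)
      also have "\<dots> = 0"
      proof -
        have "?p \<in> task_null \<tau>" by (rule task_P_in_null)
        moreover have "p \<bullet> (task_C \<tau> *v w) = 0" if "p \<in> task_null \<tau>" for p
          using that by (simp add: task_C_apply gram_map_def inner_sum_right row_null_def inner_commute)
        ultimately show ?thesis by blast
      qed
      finally show ?thesis by simp
    qed
    then show ?case
      by (simp add: u_Suc matrix_vector_mult_diff_distrib matrix_vector_mult_scaleR Suc)
  qed
  define q where "q m = c * (u m \<bullet> (task_C \<tau> *v u m))" for m
  have q_nonneg: "q m \<ge> 0" for m
    using c by (auto simp: q_def inner_task_C intro!: mult_nonneg_nonneg divide_nonneg_nonneg sum_nonneg)
  have dec: "q m \<le> (norm (u m))\<^sup>2 - (norm (u (Suc m)))\<^sup>2" for m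
  proof -
    \<comment> \<open>The step lowers the squared norm by \<open>2 * q m\<close> to first order; the
      quadratic term gives back at most \<open>q m\<close>, as
      \<open>c * trace C \<le> 1\<close>.\<close>
    have "c\<^sup>2 * (norm (task_C \<tau> *v u m))\<^sup>2 \<le> c\<^sup>2 * (trace (task_C \<tau>) * (u m \<bullet> (task_C \<tau> *v u m)))"
      by (intro mult_left_mono norm_task_C_apply_le) auto
    also have "\<dots> = (c * trace (task_C \<tau>)) * q m"
      by (simp add: q_def power2_eq_square)
    also have "\<dots> \<le> 1 * q m"
      by (intro mult_right_mono c q_nonneg)
    finally have "c\<^sup>2 * (norm (task_C \<tau> *v u m))\<^sup>2 \<le> q m" by simp
    moreover have "(norm (u (Suc m)))\<^sup>2 = (norm (u m))\<^sup>2 - 2 * q m + c\<^sup>2 * (norm (task_C \<tau> *v u m))\<^sup>2"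
      unfolding u_Suc q_def power2_norm_eq_inner
      by (simp add: inner_diff_left inner_diff_right inner_commute power2_eq_square)
    ultimately show ?thesis by simp
  qed
  have "decseq (\<lambda>m. (norm (u m))\<^sup>2)"
  proof (rule decseq_SucI)
    show "(norm (u (Suc m)))\<^sup>2 \<le> (norm (u m))\<^sup>2" for m
      using dec[of m] q_nonneg[of m] by linarith
  qed
  then obtain L where L: "(\<lambda>m. (norm (u m))\<^sup>2) \<longlonglongrightarrow> L"
    using decseq_convergent[of "\<lambda>m. (norm (u m))\<^sup>2" 0] by auto
  then have "(\<lambda>m. (norm (u m))\<^sup>2 - (norm (u (Suc m)))\<^sup>2) \<longlonglongrightarrow> L - L"
    by (intro tendsto_diff LIMSEQ_Suc)
  then have q0: "q \<longlonglongrightarrow> 0"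
    by (intro real_tendsto_sandwich[of "\<lambda>_. 0" q _ "\<lambda>m. (norm (u m))\<^sup>2 - (norm (u (Suc m)))\<^sup>2"]
        always_eventually allI dec q_nonneg) simp_all
  have "(\<lambda>m. ?X i \<bullet> u m) \<longlonglongrightarrow> 0" if "i < ?n" for i
  proof -
    have "(?X i \<bullet> u m)\<^sup>2 \<le> (real ?n / c) * q m" for m
    proof -
      have "(?X i \<bullet> u m)\<^sup>2 \<le> (\<Sum>i<?n. (?X i \<bullet> u m)\<^sup>2)"
        using that by (intro member_le_sum) auto
      also have "\<dots> = (real ?n / c) * q m"
        using that c by (simp add: q_def inner_task_C)
      finally show ?thesis .
    qed
    moreover have "(\<lambda>m. (real ?n / c) * q m) \<longlonglongrightarrow> (real ?n / c) * 0"
      by (intro tendsto_intros q0)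
    ultimately have "(\<lambda>m. (?X i \<bullet> u m)\<^sup>2) \<longlonglongrightarrow> 0"
      by (intro real_tendsto_sandwich[of "\<lambda>_. 0" "\<lambda>m. (?X i \<bullet> u m)\<^sup>2" _ "\<lambda>m. (real ?n / c) * q m"]
          always_eventually allI) simp_all
    then show ?thesis
      by (simp add: power_tendsto_0_iff)
  qed
  then have "(\<lambda>m. \<Sum>i<?n. (?X i \<bullet> u m) *\<^sub>R ?Y i) \<longlonglongrightarrow> (\<Sum>i<?n. 0 *\<^sub>R ?Y i)"
    by (intro tendsto_intros) auto
  also have "(\<lambda>m. \<Sum>i<?n. (?X i \<bullet> u m) *\<^sub>R ?Y i) = u"
    using Pu by (simp add: task_P_apply fun_eq_iff)
  finally have "u \<longlonglongrightarrow> 0" by simp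
  then show ?thesis
    unfolding u_def by (simp add: LIM_zero_iff)
qed

subsection \<open>The operator \<open>S\<close> and its top eigenspace\<close>

lemma inner_matrix_mult_left:
  fixes A B C :: "real ^ 'd ^ 'd::finite"
  shows "(A ** B) \<bullet> C = B \<bullet> (transpose A ** C)"
proof -
  have "(A ** B) \<bullet> C = (\<Sum>a\<in>UNIV. \<Sum>b\<in>UNIV. \<Sum>k\<in>UNIV. A $ a $ k * B $ k $ b * C $ a $ b)"
    by (simp add: inner_vec_def matrix_matrix_mult_def sum_distrib_right)
  also have "\<dots> = (\<Sum>a\<in>UNIV. \<Sum>k\<in>UNIV. \<Sum>b\<in>UNIV. A $ a $ k * B $ k $ b * C $ a $ b)"
    by (intro sum.cong refl sum.swap)
  also have "\<dots> = (\<Sum>k\<in>UNIV. \<Sum>a\<in>UNIV. \<Sum>b\<in>UNIV. A $ a $ k * B $ k $ b * C $ a $ b)"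
    by (rule sum.swap)
  also have "\<dots> = (\<Sum>k\<in>UNIV. \<Sum>b\<in>UNIV. \<Sum>a\<in>UNIV. A $ a $ k * B $ k $ b * C $ a $ b)"
    by (intro sum.cong refl sum.swap)
  also have "\<dots> = B \<bullet> (transpose A ** C)"
    by (simp add: inner_vec_def matrix_matrix_mult_def transpose_def sum_distrib_left mult_ac)
  finally show ?thesis .
qed

lemma inner_transpose:
  fixes A B :: "real ^ 'd ^ 'd::finite"
  shows "transpose A \<bullet> transpose B = A \<bullet> B"
  unfolding inner_vec_def transpose_def by simp (rule sum.swap)

lemma inner_matrix_mult_right:
  fixes A B C :: "real ^ 'd ^ 'd::finite"
  shows "(A ** B) \<bullet> C = A \<bullet> (C ** transpose B)"
proof -
  have "(A ** B) \<bullet> C = (transpose B ** transpose A) \<bullet> transpose C"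
    by (simp add: inner_transpose flip: matrix_transpose_mul)
  also have "\<dots> = transpose A \<bullet> (B ** transpose C)"
    by (simp add: inner_matrix_mult_left)
  also have "\<dots> = transpose A \<bullet> transpose (C ** transpose B)"
    by (simp add: matrix_transpose_mul)
  finally show ?thesis by (simp only: inner_transpose)
qed

lemma trace_mult_eq_inner:
  fixes A B :: "real ^ 'd ^ 'd::finite"
  shows "trace (A ** B) = A \<bullet> transpose B"
  by (simp add: trace_def inner_vec_def matrix_matrix_mult_def transpose_def)

lemma bounded_linear_transpose:
  "bounded_linear (transpose :: real ^ 'd ^ 'd \<Rightarrow> real ^ 'd ^ 'd::finite)"
  by (simp add: linear_conv_bounded_linear[symmetric] linear_iff transpose_def vec_eq_iff)

lemma subspace_sym_mats: "subspace sym_mats"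
  by (simp add: subspace_def sym_mats_def transpose_def vec_eq_iff)

section \<open>Measurability and integrability, entry by entry\<close>

lemma borel_measurable_vecI:
  fixes f :: "'a \<Rightarrow> ('b::euclidean_space) ^ 'd::finite"
  assumes "\<And>i. (\<lambda>x. f x $ i) \<in> borel_measurable M"
  shows "f \<in> borel_measurable M"
proof (rule borel_measurable_euclidean_space[THEN iffD2, rule_format])
  fix b :: "'b ^ 'd" assume "b \<in> Basis"
  then obtain i c where "b = axis i c"
    by (auto simp: Basis_vec_def)
  then show "(\<lambda>x. f x \<bullet> b) \<in> borel_measurable M"
    using assms by (simp add: inner_axis)
qed

lemma borel_measurable_vec_nth:
  fixes f :: "'a \<Rightarrow> ('b::euclidean_space) ^ 'd::finite"
  assumes "f \<in> borel_measurable M"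
  shows "(\<lambda>x. f x $ i) \<in> borel_measurable M"
  by (rule borel_measurable_continuous_on[OF _ assms]) (intro continuous_intros)

lemma borel_measurable_linear:
  fixes g :: "'a::euclidean_space \<Rightarrow> 'b::euclidean_space"
  assumes "linear g" "f \<in> borel_measurable M"
  shows "(\<lambda>x. g (f x)) \<in> borel_measurable M"
  by (rule borel_measurable_continuous_on[OF linear_continuous_on assms(2)])
     (use assms(1) in \<open>simp add: linear_conv_bounded_linear\<close>)

lemma borel_measurable_matrix_matrix_mult:
  fixes f g :: "'a \<Rightarrow> real ^ 'd ^ 'd::finite"
  assumes "f \<in> borel_measurable M" "g \<in> borel_measurable M"
  shows "(\<lambda>x. f x ** g x) \<in> borel_measurable M"
  by (intro borel_measurable_vecI)
     (auto simp: matrix_matrix_mult_def intro!: borel_measurable_sum borel_measurable_times borel_measurable_vec_nth assms)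

lemma borel_measurable_matrix_vector_mult:
  fixes f :: "'a \<Rightarrow> real ^ 'd ^ 'd::finite"
  assumes "f \<in> borel_measurable M" "g \<in> borel_measurable M"
  shows "(\<lambda>x. f x *v g x) \<in> borel_measurable M"
  by (intro borel_measurable_vecI)
     (auto simp: matrix_vector_mult_def intro!: borel_measurable_sum borel_measurable_times borel_measurable_vec_nth assms)

lemma integrable_vecI:
  fixes f :: "'a \<Rightarrow> ('b::euclidean_space) ^ 'd::finite"
  assumes "\<And>i. integrable M (\<lambda>x. f x $ i)"
  shows "integrable M f"
proof (rule Bochner_Integration.integrable_bound)
  show "integrable M (\<lambda>x. \<Sum>i\<in>UNIV. norm (f x $ i))"
    using assms by (intro Bochner_Integration.integrable_sum integrable_norm)
  show "f \<in> borel_measurable M"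
    using assms by (intro borel_measurable_vecI borel_measurable_integrable)
  show "AE x in M. norm (f x) \<le> norm (\<Sum>i\<in>UNIV. norm (f x $ i))"
    by (auto simp: norm_vec_def sum_nonneg intro!: L2_set_le_sum)
qed

lemma integrable_vec_nth:
  fixes f :: "'a \<Rightarrow> ('b::euclidean_space) ^ 'd::finite"
  assumes "integrable M f"
  shows "integrable M (\<lambda>x. f x $ i)"
  using assms by (rule integrable_bounded_linear[OF bounded_linear_vec_nth])

lemma integral_vec_nth:
  fixes f :: "'a \<Rightarrow> ('b::euclidean_space) ^ 'd::finite"
  assumes "integrable M f"
  shows "(\<integral>x. f x \<partial>M) $ i = (\<integral>x. f x $ i \<partial>M)"
  using assms by (rule integral_bounded_linear[OF bounded_linear_vec_nth, symmetric])

section \<open>Operator norms relative to an invariant subspace\<close>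

lemma onorm_on_bdd_above:
  assumes "bounded_linear f"
  shows "bdd_above ((\<lambda>x. norm (f x) / norm x) ` V)"
proof -
  obtain K where K: "K > 0" "\<And>x. norm (f x) \<le> norm x * K"
    using bounded_linear.pos_bounded[OF assms] by blast
  \<comment> \<open>At \<open>x = 0\<close> the quotient is \<open>0\<close> by the convention for
    division by zero.\<close>
  have "norm (f x) / norm x \<le> K" for x
    using K by (cases "norm x = 0") (auto simp: divide_simps mult.commute)
  then show ?thesis by (auto intro!: bdd_aboveI)
qed

lemma norm_le_onorm_on:
  assumes "bounded_linear f" "x \<in> V"
  shows "norm (f x) \<le> onorm_on V f * norm x"
proof (cases "x = 0")
  case True
  then show ?thesis using linear_0[OF bounded_linear.linear[OF assms(1)]] by simp
next
  case False
  have "norm (f x) / norm x \<le> onorm_on V f"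
    unfolding onorm_on_def by (intro cSUP_upper onorm_on_bdd_above assms)
  with False show ?thesis by (simp add: divide_simps)
qed

lemma onorm_on_nonneg:
  assumes "bounded_linear f" "x \<in> V"
  shows "onorm_on V f \<ge> 0"
proof -
  have "norm (f x) / norm x \<le> onorm_on V f"
    unfolding onorm_on_def by (intro cSUP_upper onorm_on_bdd_above assms)
  then show ?thesis
    by (meson divide_nonneg_nonneg norm_ge_zero order_trans)
qed

lemma funpow_mem:
  assumes "\<And>x. x \<in> V \<Longrightarrow> f x \<in> V" "x \<in> V"
  shows "(f ^^ m) x \<in> V"
  using assms by (induction m) auto

lemma norm_funpow_le_onorm_on:
  assumes f: "bounded_linear f" and V: "\<And>x. x \<in> V \<Longrightarrow> f x \<in> V" and x: "x \<in> V"
  shows "norm ((f ^^ m) x) \<le> onorm_on V f ^ m * norm x"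
proof (induction m)
  case (Suc m)
  have "norm ((f ^^ Suc m) x) \<le> onorm_on V f * norm ((f ^^ m) x)"
    using norm_le_onorm_on[OF f funpow_mem[OF V x]] by simp
  also have "\<dots> \<le> onorm_on V f * (onorm_on V f ^ m * norm x)"
    by (intro mult_left_mono Suc onorm_on_nonneg[OF f x])
  finally show ?case by (simp add: mult_ac)
qed simp

lemma linear_funpow:
  fixes f :: "'a::real_vector \<Rightarrow> 'a"
  assumes "linear f"
  shows "linear (f ^^ m)"
  using assms by (induction m) (simp_all add: linear_iff)

section \<open>Conjugation by P as a Frobenius-orthogonal projection\<close>

lemma task_P_idem: "task_P \<tau> ** task_P \<tau> = task_P \<tau>"
  by (simp add: matrix_eq matrix_vector_mul_assoc[symmetric] task_P_fixes_null task_P_in_null)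

abbreviation task_conj :: "('d::finite) task \<Rightarrow> real ^ 'd ^ 'd \<Rightarrow> real ^ 'd ^ 'd" where
  "task_conj \<tau> A \<equiv> task_P \<tau> ** A ** task_P \<tau>"

lemma inner_task_conj: "task_conj \<tau> A \<bullet> B = A \<bullet> task_conj \<tau> B"
proof -
  have "task_conj \<tau> A \<bullet> B = (task_P \<tau> ** A) \<bullet> (B ** task_P \<tau>)"
    by (simp add: inner_matrix_mult_right[of "task_P \<tau> ** A"])
  also have "\<dots> = A \<bullet> task_conj \<tau> B"
    by (simp add: inner_matrix_mult_left matrix_mul_assoc)
  finally show ?thesis .
qed

lemma linear_task_conj: "linear (task_conj \<tau>)"
  by (rule linearI)
     (simp_all add: vec_eq_iff matrix_matrix_mult_def algebra_simps sum.distrib sum_distrib_left)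

text \<open>Conjugation by \<open>P\<close> is idempotent and self-adjoint for the Frobenius
  product, hence a contraction by Cauchy-Schwarz.\<close>

lemma norm_task_conj_le: "norm (task_conj \<tau> A) \<le> norm A"
proof -
  have idem: "task_conj \<tau> (task_conj \<tau> A) = task_conj \<tau> A"
    by (metis matrix_mul_assoc task_P_idem)
  have "norm (task_conj \<tau> A) ^ 2 \<le> norm A * norm (task_conj \<tau> A)"
    unfolding power2_norm_eq_inner
    by (subst inner_task_conj, subst idem) (rule norm_cauchy_schwarz)
  then show ?thesis
    by (metis mult_right_le_imp_le norm_ge_zero order_le_less power2_eq_square)
qed

lemma transpose_task_conj: "transpose (task_conj \<tau> A) = task_conj \<tau> (transpose A)"
  by (simp add: matrix_transpose_mul matrix_mul_assoc)

section \<open>S as a self-adjoint operator on symmetric matrices\<close>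

locale task_distribution = prob_space D for D :: "('d::finite) task measure" +
  assumes integrable_task_C: "integrable D task_C"
begin

lemma borel_measurable_task_C: "task_C \<in> borel_measurable D"
  using integrable_task_C by (rule borel_measurable_integrable)

lemma borel_measurable_landweber: "(\<lambda>\<tau>. landweber \<tau> v m) \<in> borel_measurable D"
proof (induction m)
  case (Suc m)
  have "(\<lambda>\<tau>. trace (task_C \<tau>)) \<in> borel_measurable D"
    unfolding trace_def
    by (intro borel_measurable_sum borel_measurable_vec_nth borel_measurable_task_C)
  then show ?case
    unfolding landweber.simps
    by (intro borel_measurable_diff borel_measurable_scaleR borel_measurable_divide borel_measurable_add
        borel_measurable_const borel_measurable_matrix_vector_mult borel_measurable_task_C Suc)
qed simp

text \<open>Each column of \<open>P\<close> is a pointwise limit of Landweber iterates, which depend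
  on the task only through the measurable matrix \<open>C\<close>.\<close>

lemma borel_measurable_task_P: "task_P \<in> borel_measurable D"
proof (intro borel_measurable_vecI)
  fix a b
  have "(\<lambda>\<tau>. task_P \<tau> *v axis b 1) \<in> borel_measurable D"
    by (rule borel_measurable_LIMSEQ_metric[OF borel_measurable_landweber landweber_tendsto_task_P])
  then show "(\<lambda>\<tau>. task_P \<tau> $ a $ b) \<in> borel_measurable D"
    unfolding task_P_nth by (rule borel_measurable_vec_nth)
qed

text \<open>The weight \<open>f\<close> will be \<open>1\<close> or an entry of \<open>C\<close>.
  Conjugation does not increase the norm, so \<open>K * norm (f \<tau>)\<close> dominates.\<close>

lemma integrable_task_conj:
  assumes "integrable D f" "h \<in> borel_measurable D" "\<And>\<tau>. norm (h \<tau>) \<le> K"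
  shows "integrable D (\<lambda>\<tau>. f \<tau> *\<^sub>R task_conj \<tau> (h \<tau>))"
proof (rule Bochner_Integration.integrable_bound)
  show "integrable D (\<lambda>\<tau>. K * norm (f \<tau>))"
    by (intro integrable_mult_right integrable_norm assms)
  show "(\<lambda>\<tau>. f \<tau> *\<^sub>R task_conj \<tau> (h \<tau>)) \<in> borel_measurable D"
    using assms by (intro borel_measurable_scaleR borel_measurable_matrix_matrix_mult borel_measurable_task_P) auto
  have "norm (f \<tau> *\<^sub>R task_conj \<tau> (h \<tau>)) \<le> norm (K * norm (f \<tau>))" for \<tau>
  proof -
    have "\<bar>f \<tau>\<bar> * norm (task_conj \<tau> (h \<tau>)) \<le> \<bar>f \<tau>\<bar> * K"
      by (intro mult_left_mono order.trans[OF norm_task_conj_le assms(3)]) simp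
    then show ?thesis by (simp add: abs_mult mult.commute) (smt (verit) mult_right_mono)
  qed
  then show "AE \<tau> in D. norm (f \<tau> *\<^sub>R task_conj \<tau> (h \<tau>)) \<le> norm (K * norm (f \<tau>))"
    by simp
qed

lemma integrable_task_conj_const: "integrable D (\<lambda>\<tau>. task_conj \<tau> A)"
  using integrable_task_conj[of "\<lambda>_. 1" "\<lambda>_. A" "norm A"] by simp

lemma linear_S_op: "linear (S_op D)"
proof (rule linearI)
  show "S_op D (A + B) = S_op D A + S_op D B" for A B
    unfolding S_op_def linear_add[OF linear_task_conj]
    by (intro Bochner_Integration.integral_add integrable_task_conj_const)
  show "S_op D (r *\<^sub>R A) = r *\<^sub>R S_op D A" for r A
    unfolding S_op_def linear_scale[OF linear_task_conj] by (rule integral_scaleR_right)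
qed

lemma bounded_linear_S_op: "bounded_linear (S_op D)"
  using linear_S_op by (simp add: linear_conv_bounded_linear)

lemma bounded_linear_S_pow: "bounded_linear (S_op D ^^ m)"
  using linear_funpow[OF linear_S_op] by (simp add: linear_conv_bounded_linear)

lemma inner_S_op: "S_op D A \<bullet> B = A \<bullet> S_op D B"
proof -
  have "S_op D A \<bullet> B = (\<integral>\<tau>. task_conj \<tau> A \<bullet> B \<partial>D)"
    unfolding S_op_def by (rule integral_inner_left[symmetric]) (rule integrable_task_conj_const)
  also have "\<dots> = A \<bullet> S_op D B"
    unfolding S_op_def inner_task_conj
    by (rule integral_inner_right) (rule integrable_task_conj_const)
  finally show ?thesis .
qed

lemma inner_S_pow: "(S_op D ^^ m) A \<bullet> B = A \<bullet> (S_op D ^^ m) B"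
  by (induction m arbitrary: A) (simp_all add: inner_S_op funpow_swap1)

lemma S_op_sym: "A \<in> sym_mats \<Longrightarrow> S_op D A \<in> sym_mats"
proof -
  assume "A \<in> sym_mats"
  then have "transpose (task_conj \<tau> A) = task_conj \<tau> A" for \<tau>
    by (simp add: transpose_task_conj sym_mats_def)
  then have "transpose (S_op D A) = S_op D A"
    unfolding S_op_def
    using integral_bounded_linear[OF bounded_linear_transpose integrable_task_conj_const, of A] by simp
  then show ?thesis by (simp add: sym_mats_def)
qed

section \<open>The projector Q onto the top eigenspace\<close>

lemma subspace_top_eigenspace: "subspace (top_eigenspace D)"
  using subspace_sym_mats
  by (auto simp: top_eigenspace_def subspace_def linear_0[OF linear_S_op] linear_add[OF linear_S_op]
      linear_scale[OF linear_S_op] scaleR_add_right)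

lemma top_proj_unique:
  assumes "Z \<in> top_eigenspace D" "\<And>Y. Y \<in> top_eigenspace D \<Longrightarrow> orthogonal (A - Z) Y"
    and "Z' \<in> top_eigenspace D" "\<And>Y. Y \<in> top_eigenspace D \<Longrightarrow> orthogonal (A - Z') Y"
  shows "Z = Z'"
proof -
  have "Z - Z' \<in> top_eigenspace D"
    using subspace_top_eigenspace assms by (intro subspace_diff)
  then have "(A - Z) \<bullet> (Z - Z') = 0" "(A - Z') \<bullet> (Z - Z') = 0"
    using assms by (auto simp: orthogonal_def)
  then have "(Z - Z') \<bullet> (Z - Z') = 0"
    by (simp add: inner_diff_left)
  then show ?thesis by simp
qed

text \<open>Existence is the orthogonal decomposition along a finite-dimensional subspace. With
  uniqueness it turns the definite description in \<open>top_proj\<close> into a usable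
  value.\<close>

lemma top_proj_props:
  "top_proj D A \<in> top_eigenspace D \<and> (\<forall>Y\<in>top_eigenspace D. orthogonal (A - top_proj D A) Y)"
  unfolding top_proj_def
proof (rule theI')
  obtain y z where "y \<in> span (top_eigenspace D)"
    "\<And>w. w \<in> span (top_eigenspace D) \<Longrightarrow> orthogonal z w" "A = y + z"
  proof (rule orthogonal_subspace_decomp_exists[of "top_eigenspace D" A])
    fix y z
    assume "y \<in> span (top_eigenspace D)" "\<And>w. w \<in> span (top_eigenspace D) \<Longrightarrow> orthogonal z w" "A = y + z"
    then show thesis by (rule that)
  qed
  moreover have "span (top_eigenspace D) = top_eigenspace D"
    using subspace_top_eigenspace span_eq_iff by blast
  ultimately have y: "y \<in> top_eigenspace D" "\<And>Y. Y \<in> top_eigenspace D \<Longrightarrow> orthogonal (A - y) Y"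
    by auto
  show "\<exists>!Z. Z \<in> top_eigenspace D \<and> (\<forall>Y\<in>top_eigenspace D. orthogonal (A - Z) Y)"
  proof (rule ex1I[of _ y])
    show "Z = y" if "Z \<in> top_eigenspace D \<and> (\<forall>Y\<in>top_eigenspace D. orthogonal (A - Z) Y)" for Z
      by (rule top_proj_unique[of Z A y]) (use that y in auto)
  qed (use y in simp)
qed

lemma top_proj_mem: "top_proj D A \<in> top_eigenspace D"
  using top_proj_props by blast

lemma top_proj_orthogonal: "Y \<in> top_eigenspace D \<Longrightarrow> orthogonal (A - top_proj D A) Y"
  using top_proj_props by blast

lemma top_proj_eqI:
  assumes "Z \<in> top_eigenspace D" "\<And>Y. Y \<in> top_eigenspace D \<Longrightarrow> orthogonal (A - Z) Y"
  shows "top_proj D A = Z"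
  using top_proj_unique[OF top_proj_mem top_proj_orthogonal assms] .

text \<open>The defining property is preserved by sums and multiples and determines the projection.
  Linearity is what later makes \<open>top_proj D (task_C \<tau>)\<close> measurable and
  integrable.\<close>

lemma linear_top_proj: "linear (top_proj D)"
proof (rule linearI)
  fix A B and r :: real
  show "top_proj D (A + B) = top_proj D A + top_proj D B"
  proof (rule top_proj_eqI)
    show "top_proj D A + top_proj D B \<in> top_eigenspace D"
      by (intro subspace_add subspace_top_eigenspace top_proj_mem)
    show "orthogonal (A + B - (top_proj D A + top_proj D B)) Y" if "Y \<in> top_eigenspace D" for Y
      using top_proj_orthogonal[OF that, of A] top_proj_orthogonal[OF that, of B]
      by (simp add: orthogonal_def inner_diff_left inner_add_left)
  qed
  show "top_proj D (r *\<^sub>R A) = r *\<^sub>R top_proj D A"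
  proof (rule top_proj_eqI)
    show "r *\<^sub>R top_proj D A \<in> top_eigenspace D"
      by (intro subspace_scale subspace_top_eigenspace top_proj_mem)
    show "orthogonal (r *\<^sub>R A - r *\<^sub>R top_proj D A) Y" if "Y \<in> top_eigenspace D" for Y
      using top_proj_orthogonal[OF that, of A]
      by (simp add: orthogonal_def inner_diff_left)
  qed
qed

lemma norm_top_proj_pythagoras: "(norm A)\<^sup>2 = (norm (top_proj D A))\<^sup>2 + (norm (A - top_proj D A))\<^sup>2"
  using norm_add_Pythagorean[of "top_proj D A" "A - top_proj D A"] top_proj_orthogonal[OF top_proj_mem]
  by (simp add: orthogonal_commute)

lemma norm_top_proj_le: "norm (top_proj D A) \<le> norm A" "norm (A - top_proj D A) \<le> norm A"
  by (rule power2_le_imp_le; simp add: norm_top_proj_pythagoras[of A])+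

lemma rho_nonneg: "rho D \<ge> 0"
  unfolding rho_def
  by (rule onorm_on_nonneg[OF bounded_linear_S_op subspace_0[OF subspace_sym_mats]])

lemma eta_nonneg: "eta D \<ge> 0"
  unfolding eta_def
  by (rule onorm_on_nonneg[OF bounded_linear_S_op, of 0])
     (simp add: orthogonal_def subspace_0[OF subspace_sym_mats])

lemma norm_S_pow_le: "A \<in> sym_mats \<Longrightarrow> norm ((S_op D ^^ m) A) \<le> rho D ^ m * norm A"
  unfolding rho_def by (rule norm_funpow_le_onorm_on[OF bounded_linear_S_op S_op_sym])

lemma S_pow_top_eigenspace:
  assumes "Y \<in> top_eigenspace D"
  shows "(S_op D ^^ m) Y = rho D ^ m *\<^sub>R Y"
  using assms by (induction m) (simp_all add: top_eigenspace_def linear_scale[OF linear_S_op])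

text \<open>The left side is \<open>S^m\<close> applied to \<open>A - Q A\<close>, because
  \<open>S\<close> acts on \<open>Q A\<close> as multiplication by \<open>rho D\<close>. By
  self-adjointness \<open>S\<close> maps the complement of the eigenspace into itself, so each
  application costs a factor \<open>eta D\<close>.\<close>

lemma norm_S_pow_remainder_le:
  assumes "A \<in> sym_mats"
  shows "norm ((S_op D ^^ m) A - rho D ^ m *\<^sub>R top_proj D A) \<le> eta D ^ m * norm A"
proof -
  let ?V = "{A \<in> sym_mats. \<forall>Y\<in>top_eigenspace D. orthogonal A Y}" and ?R = "A - top_proj D A"
  have "?R \<in> ?V"
    using assms top_proj_mem[of A] top_proj_orthogonal
    by (auto simp: top_eigenspace_def intro!: subspace_diff subspace_sym_mats)
  moreover have "S_op D B \<in> ?V" if "B \<in> ?V" for B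
    using that by (auto simp: S_op_sym orthogonal_def inner_S_op top_eigenspace_def)
  ultimately have "norm ((S_op D ^^ m) ?R) \<le> eta D ^ m * norm ?R"
    unfolding eta_def by (intro norm_funpow_le_onorm_on[OF bounded_linear_S_op])
  also have "\<dots> \<le> eta D ^ m * norm A"
    by (intro mult_left_mono norm_top_proj_le) (simp add: eta_nonneg)
  also have "(S_op D ^^ m) ?R = (S_op D ^^ m) A - rho D ^ m *\<^sub>R top_proj D A"
    by (simp add: linear_diff[OF linear_funpow[OF linear_S_op]] S_pow_top_eigenspace top_proj_mem)
  finally show ?thesis .
qed

lemma integrable_inner_task_conj:
  fixes L :: "real ^ 'd ^ 'd \<Rightarrow> real ^ 'd ^ 'd"
  assumes "linear L"
  shows "integrable D (\<lambda>\<tau>. L (task_C \<tau>) \<bullet> task_conj \<tau> B)"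
proof (rule Bochner_Integration.integrable_bound)
  have L: "bounded_linear L" using assms by (simp add: linear_conv_bounded_linear)
  show "integrable D (\<lambda>\<tau>. norm (L (task_C \<tau>)) * norm B)"
    by (intro integrable_mult_left integrable_norm integrable_bounded_linear[OF L] integrable_task_C)
  show "(\<lambda>\<tau>. L (task_C \<tau>) \<bullet> task_conj \<tau> B) \<in> borel_measurable D"
    by (intro borel_measurable_inner borel_measurable_linear[OF assms] borel_measurable_task_C
        borel_measurable_integrable[OF integrable_task_conj_const])
  have "norm (L (task_C \<tau>) \<bullet> task_conj \<tau> B) \<le> norm (norm (L (task_C \<tau>)) * norm B)" for \<tau>
  proof -
    have "norm (L (task_C \<tau>) \<bullet> task_conj \<tau> B) \<le> norm (L (task_C \<tau>)) * norm (task_conj \<tau> B)"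
      by (simp add: Cauchy_Schwarz_ineq2)
    also have "\<dots> \<le> norm (L (task_C \<tau>)) * norm B"
      by (intro mult_left_mono norm_task_conj_le) simp
    finally show ?thesis by simp
  qed
  then show "AE \<tau> in D. norm (L (task_C \<tau>) \<bullet> task_conj \<tau> B) \<le> norm (norm (L (task_C \<tau>)) * norm B)"
    by simp
qed

section \<open>The expected loss on one task and its spectral estimate\<close>

lemma c_top_eq_inner:
  "c_top D w = (\<integral>\<tau>. top_proj D (task_C \<tau>) \<bullet> task_conj \<tau> (top_proj D (outer_self w)) \<partial>D)"
proof -
  have "transpose (top_proj D (outer_self w)) = top_proj D (outer_self w)"
    using top_proj_mem[of "outer_self w"] by (simp add: top_eigenspace_def sym_mats_def)
  then have "trace (top_proj D (task_C \<tau>) ** task_P \<tau> ** top_proj D (outer_self w) ** task_P \<tau>)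
      = top_proj D (task_C \<tau>) \<bullet> task_conj \<tau> (top_proj D (outer_self w))" for \<tau>
    using trace_mult_eq_inner[of "top_proj D (task_C \<tau>)" "task_conj \<tau> (top_proj D (outer_self w))"]
    by (simp add: transpose_task_conj matrix_mul_assoc)
  then show ?thesis by (simp add: c_top_def)
qed

text \<open>For the matrix \<open>outer_self w\<close> of a common solution \<open>w\<close>, this
  is the expected loss on task \<open>j + 1\<close> of the iterate \<open>j + 1 + m\<close>:
  \<open>j\<close> projections come before that task and \<open>m\<close> after it, the latter moved
  onto \<open>C\<close> by self-adjointness.\<close>

definition mean_loss :: "nat \<Rightarrow> nat \<Rightarrow> real ^ 'd ^ 'd \<Rightarrow> real" where
  "mean_loss m j A = (\<integral>\<tau>. (S_op D ^^ m) (task_C \<tau>) \<bullet> task_conj \<tau> ((S_op D ^^ j) A) \<partial>D)"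

lemma outer_self_sym: "outer_self w \<in> sym_mats"
  by (simp add: sym_mats_def outer_self_def transpose_def vec_eq_iff mult.commute)

text \<open>The powers of \<open>S\<close> are replaced by their top parts one factor at a time.
  Replacing the one on \<open>C\<close> costs \<open>eta^m rho^j\<close>, the one on
  \<open>outer_self w\<close> costs \<open>rho^m eta^j\<close>; the bound is pointwise in the task
  and linear in \<open>norm C\<close>, so it can be integrated.\<close>

lemma mean_loss_bound:
  "\<bar>mean_loss m j (outer_self w) - c_top D w * rho D ^ (m + j)\<bar>
     \<le> (\<integral>\<tau>. norm (task_C \<tau>) \<partial>D) * norm (outer_self w) * (eta D ^ m * rho D ^ j + rho D ^ m * eta D ^ j)"
proof -
  let ?A = "outer_self w" and ?Q = "top_proj D" and ?S = "\<lambda>m. S_op D ^^ m"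
  have "c_top D w * rho D ^ (m + j)
      = (\<integral>\<tau>. (rho D ^ m *\<^sub>R ?Q (task_C \<tau>)) \<bullet> task_conj \<tau> (rho D ^ j *\<^sub>R ?Q ?A) \<partial>D)"
    by (simp add: c_top_eq_inner linear_scale[OF linear_task_conj] power_add mult_ac
        flip: integral_mult_right_zero)
  moreover have i1: "integrable D (\<lambda>\<tau>. ?S m (task_C \<tau>) \<bullet> task_conj \<tau> (?S j ?A))"
    by (rule integrable_inner_task_conj[OF linear_funpow[OF linear_S_op]])
  moreover have i2: "integrable D (\<lambda>\<tau>. (rho D ^ m *\<^sub>R ?Q (task_C \<tau>)) \<bullet> task_conj \<tau> (rho D ^ j *\<^sub>R ?Q ?A))"
    by (rule integrable_inner_task_conj[OF linear_compose_scale_right[OF linear_top_proj]])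
  ultimately have "mean_loss m j ?A - c_top D w * rho D ^ (m + j)
      = (\<integral>\<tau>. ?S m (task_C \<tau>) \<bullet> task_conj \<tau> (?S j ?A)
           - (rho D ^ m *\<^sub>R ?Q (task_C \<tau>)) \<bullet> task_conj \<tau> (rho D ^ j *\<^sub>R ?Q ?A) \<partial>D)"
    unfolding mean_loss_def
    by (simp only: Bochner_Integration.integral_diff)
  also have "\<bar>\<dots>\<bar> \<le> (\<integral>\<tau>. norm (task_C \<tau>) * (norm ?A * (eta D ^ m * rho D ^ j + rho D ^ m * eta D ^ j)) \<partial>D)"
  proof (rule order.trans[OF integral_abs_bound], rule integral_mono)
    show "integrable D (\<lambda>\<tau>. \<bar>?S m (task_C \<tau>) \<bullet> task_conj \<tau> (?S j ?A)
           - (rho D ^ m *\<^sub>R ?Q (task_C \<tau>)) \<bullet> task_conj \<tau> (rho D ^ j *\<^sub>R ?Q ?A)\<bar>)"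
      by (intro integrable_abs Bochner_Integration.integrable_diff i1 i2)
    show "integrable D (\<lambda>\<tau>. norm (task_C \<tau>) * (norm ?A * (eta D ^ m * rho D ^ j + rho D ^ m * eta D ^ j)))"
      by (intro integrable_mult_left integrable_norm integrable_task_C)
    fix \<tau> :: "'d task"
    let ?C = "task_C \<tau>"
    have C: "?C \<in> sym_mats" by (simp add: sym_mats_def)
    \<comment> \<open>The mixed term, with top part on the left and full power on the right, is
      subtracted and added.\<close>
    have "?S m ?C \<bullet> task_conj \<tau> (?S j ?A) - (rho D ^ m *\<^sub>R ?Q ?C) \<bullet> task_conj \<tau> (rho D ^ j *\<^sub>R ?Q ?A)
       = (?S m ?C - rho D ^ m *\<^sub>R ?Q ?C) \<bullet> task_conj \<tau> (?S j ?A)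
         + (rho D ^ m *\<^sub>R ?Q ?C) \<bullet> task_conj \<tau> (?S j ?A - rho D ^ j *\<^sub>R ?Q ?A)"
      unfolding linear_diff[OF linear_task_conj] by (simp only: inner_diff_left inner_diff_right)
    also have "\<bar>\<dots>\<bar> \<le> (eta D ^ m * norm ?C) * (rho D ^ j * norm ?A) + (rho D ^ m * norm ?C) * (eta D ^ j * norm ?A)"
    proof (rule order.trans[OF abs_triangle_ineq], rule add_mono)
      show "\<bar>(?S m ?C - rho D ^ m *\<^sub>R ?Q ?C) \<bullet> task_conj \<tau> (?S j ?A)\<bar> \<le> (eta D ^ m * norm ?C) * (rho D ^ j * norm ?A)"
        by (rule order.trans[OF Cauchy_Schwarz_ineq2], rule mult_mono)
           (use eta_nonneg in \<open>auto intro!: norm_S_pow_remainder_le C order.trans[OF norm_task_conj_le norm_S_pow_le] outer_self_sym\<close>)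
      have "norm (rho D ^ m *\<^sub>R ?Q ?C) \<le> rho D ^ m * norm ?C"
        using rho_nonneg by (simp add: norm_top_proj_le mult_left_mono)
      then show "\<bar>(rho D ^ m *\<^sub>R ?Q ?C) \<bullet> task_conj \<tau> (?S j ?A - rho D ^ j *\<^sub>R ?Q ?A)\<bar> \<le> (rho D ^ m * norm ?C) * (eta D ^ j * norm ?A)"
        by (intro order.trans[OF Cauchy_Schwarz_ineq2] mult_mono order.trans[OF norm_task_conj_le norm_S_pow_remainder_le] outer_self_sym)
           (use rho_nonneg in auto)
    qed
    also have "\<dots> = norm ?C * (norm ?A * (eta D ^ m * rho D ^ j + rho D ^ m * eta D ^ j))"
      by (simp add: algebra_simps)
    finally show "\<bar>?S m ?C \<bullet> task_conj \<tau> (?S j ?A) - (rho D ^ m *\<^sub>R ?Q ?C) \<bullet> task_conj \<tau> (rho D ^ j *\<^sub>R ?Q ?A)\<bar>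
       \<le> norm ?C * (norm ?A * (eta D ^ m * rho D ^ j + rho D ^ m * eta D ^ j))" .
  qed
  finally show ?thesis by (simp add: mult.assoc)
qed

end

subsection \<open>Measurability of the iterates\<close>

text \<open>Half the gradient of \<open>task_loss \<tau>\<close> at \<open>w\<close>.\<close>

definition loss_gradient :: "('d::finite) task \<Rightarrow> real ^ 'd \<Rightarrow> real ^ 'd" where
  "loss_gradient \<tau> w =
     (1 / real (task_n \<tau>)) *\<^sub>R (\<Sum>i<task_n \<tau>. (task_X \<tau> i \<bullet> w - task_y \<tau> i) *\<^sub>R task_X \<tau> i)"

text \<open>The formula refers to the task alone and to no solution of it, so it is measurable in
  the task; on a solvable task it is the Landweber iteration around any solution.\<close>

primrec descent :: "('d::finite) task \<Rightarrow> real ^ 'd \<Rightarrow> nat \<Rightarrow> real ^ 'd" where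
  "descent \<tau> w 0 = w"
| "descent \<tau> w (Suc m) =
     descent \<tau> w m - (1 / (1 + trace (task_C \<tau>))) *\<^sub>R loss_gradient \<tau> (descent \<tau> w m)"

lemma loss_gradient_solves:
  assumes "solves \<tau> v"
  shows "loss_gradient \<tau> w = task_C \<tau> *v (w - v)"
  using assms
  by (auto simp: loss_gradient_def task_C_apply gram_map_def solves_def inner_diff_right intro!: sum.cong)

lemma descent_solves:
  assumes "solves \<tau> v"
  shows "descent \<tau> w m = v + landweber \<tau> (w - v) m"
  by (induction m) (simp_all add: loss_gradient_solves[OF assms])

lemma lim_descent_solves:
  assumes "solves \<tau> v"
  shows "lim (descent \<tau> w) = v + task_P \<tau> *v (w - v)"
proof (rule limI)
  show "descent \<tau> w \<longlonglongrightarrow> v + task_P \<tau> *v (w - v)"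
    using tendsto_add[OF tendsto_const landweber_tendsto_task_P, of v \<tau> "w - v"]
    by (simp add: descent_solves[OF assms, abs_def])
qed

text \<open>
  A non-measurable integrand would have Bochner integral \<open>0\<close>, so the iterates must be shown measurable
  also on the null event where no solution exists; there the minimiser is the junk value \<open>SOME w. False\<close>.
\<close>

lemma iterate_Suc_eq_lim:
  "iterate x (Suc t) =
     (if solves (x (Suc t)) (lim (descent (x (Suc t)) (iterate x t)))
      then lim (descent (x (Suc t)) (iterate x t)) else (SOME w. False))"
proof (cases "\<exists>v. solves (x (Suc t)) v")
  case True
  then obtain v where v: "solves (x (Suc t)) v" by blast
  have lim: "lim (descent (x (Suc t)) (iterate x t)) = iterate x (Suc t)"
    unfolding lim_descent_solves[OF v] iterate_Suc[where x = x and t = t, OF v, symmetric] by simp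
  have "task_P (x (Suc t)) *v (iterate x t - v) \<in> task_null (x (Suc t))"
    by (rule task_P_in_null)
  then have "solves (x (Suc t)) (iterate x (Suc t))"
    unfolding iterate_Suc[where x = x and t = t, OF v, symmetric]
    using v by (simp add: solves_def row_null_def inner_diff_right del: iterate.simps)
  then show ?thesis by (simp only: lim if_True)
next
  case False
  then show ?thesis by (simp add: arg_min_def is_arg_min_def)
qed

lemma
  assumes "T \<in> measurable M task_space"
  shows measurable_task_n: "(\<lambda>\<omega>. task_n (T \<omega>)) \<in> measurable M (count_space UNIV)"
    and measurable_task_X: "(\<lambda>\<omega>. task_X (T \<omega>) i) \<in> borel_measurable M"
    and measurable_task_y: "(\<lambda>\<omega>. task_y (T \<omega>) i) \<in> borel_measurable M"
proof -
  have T: "T \<in> measurable M (count_space UNIV \<Otimes>\<^sub>M ((\<Pi>\<^sub>M i\<in>UNIV. borel) \<Otimes>\<^sub>M (\<Pi>\<^sub>M i\<in>UNIV. borel)))"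
    using assms unfolding task_space_def by (simp add: measurable_restrict_space2_iff)
  show "(\<lambda>\<omega>. task_n (T \<omega>)) \<in> measurable M (count_space UNIV)"
    by (rule measurable_compose[OF T measurable_fst])
  have T2: "(\<lambda>\<omega>. snd (T \<omega>)) \<in> measurable M ((\<Pi>\<^sub>M i\<in>UNIV. borel) \<Otimes>\<^sub>M (\<Pi>\<^sub>M i\<in>UNIV. borel))"
    by (rule measurable_compose[OF T measurable_snd])
  show "(\<lambda>\<omega>. task_X (T \<omega>) i) \<in> borel_measurable M"
    by (rule measurable_compose[OF measurable_compose[OF T2 measurable_fst] measurable_component_singleton]) simp
  show "(\<lambda>\<omega>. task_y (T \<omega>) i) \<in> borel_measurable M"
    by (rule measurable_compose[OF measurable_compose[OF T2 measurable_snd] measurable_component_singleton]) simp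
qed

context
  fixes M :: "'w measure" and T :: "'w \<Rightarrow> ('d::finite) task" and w :: "'w \<Rightarrow> real ^ 'd"
  assumes T: "T \<in> measurable M task_space" and w: "w \<in> borel_measurable M"
begin

text \<open>The number of rows is random but countably valued, so measurability can be checked for
  each fixed number of rows.\<close>

lemma borel_measurable_sum_rows:
  fixes F :: "nat \<Rightarrow> 'w \<Rightarrow> 'b::euclidean_space"
  assumes "\<And>i. F i \<in> borel_measurable M"
  shows "(\<lambda>\<omega>. \<Sum>i<task_n (T \<omega>). F i \<omega>) \<in> borel_measurable M"
  by (rule measurable_compose_countable[OF _ measurable_task_n[OF T], where f = "\<lambda>n \<omega>. \<Sum>i<n. F i \<omega>"])
     (intro borel_measurable_sum assms)

lemma borel_measurable_real_task_n: "(\<lambda>\<omega>. real (task_n (T \<omega>))) \<in> borel_measurable M"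
  by (rule measurable_compose[OF measurable_task_n[OF T]]) simp

lemma borel_measurable_trace_task_C: "(\<lambda>\<omega>. trace (task_C (T \<omega>))) \<in> borel_measurable M"
  unfolding trace_task_C
  by (intro borel_measurable_divide borel_measurable_sum_rows borel_measurable_power
      measurable_compose[OF measurable_task_X[OF T] borel_measurable_norm] borel_measurable_real_task_n)

lemma borel_measurable_loss_gradient: "(\<lambda>\<omega>. loss_gradient (T \<omega>) (w \<omega>)) \<in> borel_measurable M"
  unfolding loss_gradient_def
  by (intro borel_measurable_scaleR borel_measurable_divide borel_measurable_const borel_measurable_real_task_n
      borel_measurable_sum_rows borel_measurable_diff borel_measurable_inner measurable_task_X[OF T]
      measurable_task_y[OF T] w)

lemma borel_measurable_task_loss: "(\<lambda>\<omega>. task_loss (T \<omega>) (w \<omega>)) \<in> borel_measurable M"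
  unfolding task_loss_def L2_set_def
  by (intro borel_measurable_times borel_measurable_divide borel_measurable_const borel_measurable_real_task_n
      borel_measurable_sum_rows borel_measurable_diff borel_measurable_inner measurable_task_X[OF T]
      measurable_task_y[OF T] w borel_measurable_power
      measurable_compose[OF _ borel_measurable_sqrt])

lemma measurable_solves: "Measurable.pred M (\<lambda>\<omega>. solves (T \<omega>) (w \<omega>))"
proof -
  have "(\<lambda>\<omega>. task_X (T \<omega>) i \<bullet> w \<omega>) \<in> borel_measurable M" for i
    by (intro borel_measurable_inner measurable_task_X[OF T] w)
  then have "Measurable.pred M (\<lambda>\<omega>. i < n \<longrightarrow> task_X (T \<omega>) i \<bullet> w \<omega> = task_y (T \<omega>) i)" for n i
    using measurable_task_y[OF T, of i] by measurable
  then have "Measurable.pred M (\<lambda>\<omega>. \<forall>i<n. task_X (T \<omega>) i \<bullet> w \<omega> = task_y (T \<omega>) i)" for n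
    by measurable
  then show ?thesis
    unfolding solves_def
    by (rule measurable_compose_countable[OF _ measurable_task_n[OF T],
          where f = "\<lambda>n \<omega>. \<forall>i<n. task_X (T \<omega>) i \<bullet> w \<omega> = task_y (T \<omega>) i"])
qed

end

lemma borel_measurable_descent:
  assumes T: "T \<in> measurable M task_space" and w: "w \<in> borel_measurable M"
  shows "(\<lambda>\<omega>. descent (T \<omega>) (w \<omega>) m) \<in> borel_measurable M"
proof (induction m)
  case (Suc m)
  then show ?case
    unfolding descent.simps
    by (intro borel_measurable_diff borel_measurable_scaleR borel_measurable_divide borel_measurable_add
        borel_measurable_const borel_measurable_loss_gradient borel_measurable_trace_task_C T)
qed (simp add: w)

lemma borel_measurable_iterate:
  assumes T: "\<And>t. t \<ge> 1 \<Longrightarrow> T t \<in> measurable M task_space"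
  shows "(\<lambda>\<omega>. iterate (\<lambda>s. T s \<omega>) t) \<in> borel_measurable M"
proof (induction t)
  case (Suc t)
  \<comment> \<open>The pointwise \<open>lim\<close> of measurable functions is measurable even
    where the sequence diverges, so no convergence has to be shown.\<close>
  have "(\<lambda>\<omega>. lim (descent (T (Suc t) \<omega>) (iterate (\<lambda>s. T s \<omega>) t))) \<in> borel_measurable M"
    by (intro borel_measurable_lim_metric borel_measurable_descent T Suc) simp
  then show ?case
    unfolding iterate_Suc_eq_lim
    by (intro measurable_If measurable_solves[unfolded pred_def] T borel_measurable_const) simp_all
qed simp

subsection \<open>Expected losses\<close>

text \<open>The product \<open>P_s ... P_1 A P_1 ... P_s\<close>.\<close>

primrec conj_chain :: "(nat \<Rightarrow> ('d::finite) task) \<Rightarrow> real ^ 'd ^ 'd \<Rightarrow> nat \<Rightarrow> real ^ 'd ^ 'd" where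
  "conj_chain x A 0 = A"
| "conj_chain x A (Suc s) = task_conj (x (Suc s)) (conj_chain x A s)"

text \<open>This is what makes the chain independent of the tasks after \<open>s\<close>.\<close>

lemma conj_chain_cong:
  assumes "\<And>i. i \<in> {1..s} \<Longrightarrow> x i = y i"
  shows "conj_chain x A s = conj_chain y A s"
  using assms by (induction s) auto

lemma task_conj_outer_self: "task_conj \<tau> (outer_self e) = outer_self (task_P \<tau> *v e)"
proof -
  have P: "task_P \<tau> $ d $ b = task_P \<tau> $ b $ d" for b d
    using transpose_task_P[of \<tau>] by (simp add: vec_eq_iff transpose_def)
  have "(task_P \<tau> ** outer_self e) $ a $ d = (task_P \<tau> *v e) $ a * e $ d" for a d
    by (simp add: matrix_matrix_mult_def matrix_vector_mult_def outer_self_def sum_distrib_left mult_ac)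
  then have "task_conj \<tau> (outer_self e) $ a $ b = (\<Sum>d\<in>UNIV. (task_P \<tau> *v e) $ a * e $ d * task_P \<tau> $ d $ b)" for a b
    by (subst matrix_matrix_mult_def) simp
  also have "\<dots> a b = (task_P \<tau> *v e) $ a * (task_P \<tau> *v e) $ b" for a b
    by (subst (2) matrix_vector_mult_def) (simp add: sum_distrib_left P[of _ b] mult_ac)
  finally show ?thesis
    by (simp add: vec_eq_iff outer_self_def)
qed

lemma conj_chain_outer_self:
  assumes "\<And>s. s \<ge> 1 \<Longrightarrow> solves (x s) w"
  shows "conj_chain x (outer_self w) k = outer_self (iterate x k - w)"
proof (induction k)
  case 0
  \<comment> \<open>The initial error is \<open>- w\<close>, and the sign cancels in the outer
    product.\<close>
  show ?case by (simp add: outer_self_def)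
next
  case (Suc k)
  have "iterate x (Suc k) - w = task_P (x (Suc k)) *v (iterate x k - w)"
    by (rule iterate_Suc) (simp add: assms)
  then show ?case
    by (simp add: Suc task_conj_outer_self del: iterate.simps)
qed

lemma inner_outer_self: "A \<bullet> outer_self e = e \<bullet> (A *v e)"
  by (simp add: inner_vec_def outer_self_def matrix_vector_mult_def sum_distrib_left mult_ac)

lemma task_loss_solves:
  assumes "solves \<tau> w"
  shows "task_loss \<tau> v = task_C \<tau> \<bullet> outer_self (v - w)"
proof -
  have "(\<Sum>i<task_n \<tau>. (task_X \<tau> i \<bullet> v - task_y \<tau> i)\<^sup>2) = (\<Sum>i<task_n \<tau>. (task_X \<tau> i \<bullet> (v - w))\<^sup>2)"
    using assms by (intro sum.cong) (auto simp: solves_def inner_diff_right)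
  then show ?thesis
    by (simp add: inner_outer_self inner_task_C task_loss_def L2_set_def sum_nonneg)
qed

text \<open>Matrix products are expanded into scalar ones because the product rule for expectations
  of independent variables will be applied to scalars.\<close>

lemma task_conj_nth:
  "task_conj \<tau> B $ a $ b = (\<Sum>c\<in>UNIV. \<Sum>d\<in>UNIV. task_P \<tau> $ a $ c * task_P \<tau> $ d $ b * B $ c $ d)"
proof -
  have "task_conj \<tau> B $ a $ b = (\<Sum>d\<in>UNIV. \<Sum>c\<in>UNIV. task_P \<tau> $ a $ c * task_P \<tau> $ d $ b * B $ c $ d)"
    by (simp add: matrix_matrix_mult_def sum_distrib_left mult_ac)
  then show ?thesis
    by (subst sum.swap) simp
qed

section \<open>Expectations along an independent task sequence\<close>

locale iid_tasks = task_distribution D + M: prob_space M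
  for D :: "('d::finite) task measure" and M :: "'w measure" +
  fixes T :: "nat \<Rightarrow> 'w \<Rightarrow> 'd task"
  assumes sets_D: "sets D = sets task_space"
    and indep_T: "M.indep_vars (\<lambda>_. task_space) T {1..}"
    and distr_T: "\<And>t. t \<ge> 1 \<Longrightarrow> distr M task_space (T t) = D"
begin

lemma measurable_T: "t \<ge> 1 \<Longrightarrow> T t \<in> measurable M task_space"
  using indep_T by (simp add: M.indep_vars_def)

lemma borel_measurable_D_iff: "f \<in> borel_measurable D \<longleftrightarrow> f \<in> borel_measurable task_space"
  using measurable_cong_sets[OF sets_D refl] by blast

lemma
  fixes g :: "'d task \<Rightarrow> 'b::{banach, second_countable_topology}"
  assumes "t \<ge> 1" and g: "integrable D g"
  shows integrable_T: "integrable M (\<lambda>\<omega>. g (T t \<omega>))"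
    and integral_T: "(\<integral>\<omega>. g (T t \<omega>) \<partial>M) = (\<integral>\<tau>. g \<tau> \<partial>D)"
proof -
  have "g \<in> borel_measurable task_space"
    using g borel_measurable_D_iff borel_measurable_integrable by blast
  then show "integrable M (\<lambda>\<omega>. g (T t \<omega>))" "(\<integral>\<omega>. g (T t \<omega>) \<partial>M) = (\<integral>\<tau>. g \<tau> \<partial>D)"
    using integrable_distr_eq[OF measurable_T, of t g] integral_distr[OF measurable_T, of t g]
      distr_T[OF assms(1)] assms by simp_all
qed

text \<open>The index set \<open>J\<close> may exceed \<open>{1..s}\<close>, so that the induction
  can stay on one product space.\<close>

lemma borel_measurable_conj_chain:
  fixes A :: "real ^ 'd ^ 'd"
  assumes "{1..s} \<subseteq> J"
  shows "(\<lambda>x. conj_chain x A s) \<in> borel_measurable (PiM J (\<lambda>_. task_space))"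
  using assms
proof (induction s)
  case (Suc s)
  have P: "(\<lambda>x :: nat \<Rightarrow> 'd task. task_P (x (Suc s))) \<in> borel_measurable (PiM J (\<lambda>_. task_space))"
    by (rule measurable_compose[OF measurable_component_singleton])
       (use Suc.prems borel_measurable_D_iff[THEN iffD1, OF borel_measurable_task_P] in auto)
  show ?case
    unfolding conj_chain.simps
    by (intro borel_measurable_matrix_matrix_mult P Suc.IH) (use Suc.prems in auto)
qed simp

text \<open>\<open>H\<close> depends on the tasks up to \<open>s\<close> only and is thus
  independent of task \<open>s + 1\<close>, so it may be replaced by its mean. With
  \<open>f = 1\<close> the result is one application of \<open>S\<close> to that mean; with
  \<open>f\<close> an entry of \<open>C\<close> it starts the loss on task
  \<open>s + 1\<close>.\<close>

lemma
  fixes h :: "(nat \<Rightarrow> 'd task) \<Rightarrow> real ^ 'd ^ 'd" and s :: nat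
  defines "H \<equiv> \<lambda>\<omega>. h (\<lambda>j. T j \<omega>)"
  assumes f: "integrable D f"
    and h: "h \<in> borel_measurable (PiM {1..s} (\<lambda>_. task_space))"
    and h_cong: "\<And>x y. (\<And>i. i \<in> {1..s} \<Longrightarrow> x i = y i) \<Longrightarrow> h x = h y"
    and H: "integrable M H"
  shows integrable_step: "integrable M (\<lambda>\<omega>. f (T (Suc s) \<omega>) *\<^sub>R task_conj (T (Suc s) \<omega>) (H \<omega>))" (is ?int)
    and integral_step: "(\<integral>\<omega>. f (T (Suc s) \<omega>) *\<^sub>R task_conj (T (Suc s) \<omega>) (H \<omega>) \<partial>M)
      = (\<integral>\<tau>. f \<tau> *\<^sub>R task_conj \<tau> (\<integral>\<omega>. H \<omega> \<partial>M) \<partial>D)" (is ?eq)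
proof -
  \<comment> \<open>The coefficient of \<open>H $ c $ d\<close> in entry \<open>(a, b)\<close>; it
    depends on task \<open>s + 1\<close> only. Entries of \<open>P\<close> are at most
    \<open>1\<close> in absolute value, so \<open>f\<close> dominates it.\<close>
  define g where "g a b c d \<tau> = f \<tau> * (task_P \<tau> $ a $ c * task_P \<tau> $ d $ b)" for a b c d \<tau>
  have P: "(\<lambda>\<tau>. task_P \<tau> $ a $ b) \<in> borel_measurable D" for a b
    by (intro borel_measurable_vec_nth borel_measurable_task_P)
  have g: "integrable D (g a b c d)" for a b c d
  proof (rule Bochner_Integration.integrable_bound[OF f])
    show "g a b c d \<in> borel_measurable D"
      unfolding g_def by (intro borel_measurable_times P borel_measurable_integrable f)
    have "\<bar>task_P \<tau> $ a $ c * task_P \<tau> $ d $ b\<bar> \<le> 1" for \<tau>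
      using mult_mono[OF abs_task_P_le_1 abs_task_P_le_1, of \<tau> a c \<tau> d b] by (simp add: abs_mult mult.commute)
    then show "AE \<tau> in D. norm (g a b c d \<tau>) \<le> norm (f \<tau>)"
      by (simp add: g_def abs_mult mult_left_le)
  qed
  have Hcd: "integrable M (\<lambda>\<omega>. H \<omega> $ c $ d)" for c d
    by (intro integrable_vec_nth H)
  have indep: "M.indep_var borel (\<lambda>\<omega>. g a b c d (T (Suc s) \<omega>)) borel (\<lambda>\<omega>. H \<omega> $ c $ d)" for a b c d
  proof -
    let ?X1 = "\<lambda>\<omega>. restrict (\<lambda>i. T i \<omega>) {Suc s}" and ?X2 = "\<lambda>\<omega>. restrict (\<lambda>i. T i \<omega>) {1..s}"
    have "M.indep_var (PiM {Suc s} (\<lambda>_. task_space)) ?X1 (PiM {1..s} (\<lambda>_. task_space)) ?X2"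
      by (rule M.indep_var_restrict[OF indep_T]) auto
    moreover have "(\<lambda>x. g a b c d (x (Suc s))) \<in> borel_measurable (PiM {Suc s} (\<lambda>_. task_space))"
      by (rule measurable_compose[OF measurable_component_singleton])
         (use borel_measurable_D_iff[THEN iffD1, OF borel_measurable_integrable[OF g]] in auto)
    moreover have "(\<lambda>x. h x $ c $ d) \<in> borel_measurable (PiM {1..s} (\<lambda>_. task_space))"
      by (intro borel_measurable_vec_nth h)
    ultimately have "M.indep_var borel ((\<lambda>x. g a b c d (x (Suc s))) \<circ> ?X1) borel ((\<lambda>x. h x $ c $ d) \<circ> ?X2)"
      by (rule M.indep_var_compose)
    \<comment> \<open>Independence is available for the restricted sequence; \<open>h\<close> does
      not see the difference.\<close>
    moreover have "h (?X2 \<omega>) = H \<omega>" for \<omega>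
      unfolding H_def by (rule h_cong) simp
    ultimately show ?thesis
      by (simp add: comp_def)
  qed
  have entry: "(f \<tau> *\<^sub>R task_conj \<tau> B) $ a $ b = (\<Sum>c\<in>UNIV. \<Sum>d\<in>UNIV. g a b c d \<tau> * B $ c $ d)" for \<tau> B a b
    by (simp add: task_conj_nth g_def sum_distrib_left mult.assoc)
  have int: "integrable M (\<lambda>\<omega>. g a b c d (T (Suc s) \<omega>) * H \<omega> $ c $ d)" for a b c d
    by (rule M.indep_var_integrable[OF indep]) (auto intro: integrable_T g Hcd)
  show ?int
    by (intro integrable_vecI)
       (simp only: entry, intro Bochner_Integration.integrable_sum int)
  then have "(\<integral>\<omega>. f (T (Suc s) \<omega>) *\<^sub>R task_conj (T (Suc s) \<omega>) (H \<omega>) \<partial>M) $ a $ b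
      = (\<Sum>c\<in>UNIV. \<Sum>d\<in>UNIV. \<integral>\<omega>. g a b c d (T (Suc s) \<omega>) * H \<omega> $ c $ d \<partial>M)" for a b
    by (simp only: integral_vec_nth integrable_vec_nth entry)
       (simp add: Bochner_Integration.integral_sum Bochner_Integration.integrable_sum int)
  also have "\<dots> a b = (\<Sum>c\<in>UNIV. \<Sum>d\<in>UNIV. (\<integral>\<tau>. g a b c d \<tau> \<partial>D) * (\<integral>\<omega>. H \<omega> \<partial>M) $ c $ d)" for a b
    by (simp add: M.indep_var_lebesgue_integral[OF indep integrable_T[OF _ g] Hcd] integral_T[OF _ g]
        integral_vec_nth integrable_vec_nth H)
  also have "\<dots> a b = (\<integral>\<tau>. (f \<tau> *\<^sub>R task_conj \<tau> (\<integral>\<omega>. H \<omega> \<partial>M)) $ a $ b \<partial>D)" for a b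
    unfolding entry
    by (simp add: Bochner_Integration.integral_sum Bochner_Integration.integrable_sum g)
  also have "\<dots> a b = (\<integral>\<tau>. f \<tau> *\<^sub>R task_conj \<tau> (\<integral>\<omega>. H \<omega> \<partial>M) \<partial>D) $ a $ b" for a b
    by (simp only: integral_vec_nth integrable_vec_nth
        integrable_task_conj[OF f borel_measurable_const order.refl])
  finally show ?eq
    by (simp add: vec_eq_iff)
qed

lemma integrable_conj_chain: "integrable M (\<lambda>\<omega>. conj_chain (\<lambda>s. T s \<omega>) A k)" (is "?int k")
  and integral_conj_chain: "(\<integral>\<omega>. conj_chain (\<lambda>s. T s \<omega>) A k \<partial>M) = (S_op D ^^ k) A" (is "?eq k")
proof -
  have "?int k \<and> ?eq k"
  proof (induction k)
    case (Suc k)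
    have h: "(\<lambda>x. conj_chain x A k) \<in> borel_measurable (PiM {1..k} (\<lambda>_. task_space))"
      by (rule borel_measurable_conj_chain) simp
    from integrable_step[of "\<lambda>_. 1", OF _ h conj_chain_cong] integral_step[of "\<lambda>_. 1", OF _ h conj_chain_cong] Suc
    show ?case
      by (simp add: S_op_def)
  qed (simp add: M.prob_space)
  then show "?int k" "?eq k" by auto
qed

text \<open>The step for task \<open>j + 1\<close> carries the weight \<open>f\<close>. Each of the
  \<open>m\<close> later steps has weight \<open>1\<close> and acts on the whole weighted chain,
  which adds one application of \<open>S\<close>.\<close>

lemma integrable_weighted_conj_chain:
    "integrable D f \<Longrightarrow> integrable M (\<lambda>\<omega>. f (T (Suc j) \<omega>) *\<^sub>R conj_chain (\<lambda>s. T s \<omega>) A (Suc j + m))"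
    (is "_ \<Longrightarrow> ?int m")
  and integral_weighted_conj_chain:
    "integrable D f \<Longrightarrow> (\<integral>\<omega>. f (T (Suc j) \<omega>) *\<^sub>R conj_chain (\<lambda>s. T s \<omega>) A (Suc j + m) \<partial>M)
      = (S_op D ^^ m) (\<integral>\<tau>. f \<tau> *\<^sub>R task_conj \<tau> ((S_op D ^^ j) A) \<partial>D)"
    (is "_ \<Longrightarrow> ?eq m")
proof -
  assume f: "integrable D f"
  have "?int m \<and> ?eq m"
  proof (induction m)
    case 0
    have h: "(\<lambda>x. conj_chain x A j) \<in> borel_measurable (PiM {1..j} (\<lambda>_. task_space))"
      by (rule borel_measurable_conj_chain) simp
    show ?case
      using integrable_step[OF f h conj_chain_cong integrable_conj_chain]
        integral_step[OF f h conj_chain_cong integrable_conj_chain]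
      by (simp add: integral_conj_chain)
  next
    case (Suc m)
    let ?h = "\<lambda>x. f (x (Suc j)) *\<^sub>R conj_chain x A (Suc j + m)"
    have h: "?h \<in> borel_measurable (PiM {1..Suc j + m} (\<lambda>_. task_space))"
    proof (intro borel_measurable_scaleR borel_measurable_conj_chain order.refl)
      show "(\<lambda>x. f (x (Suc j))) \<in> borel_measurable (PiM {1..Suc j + m} (\<lambda>_. task_space))"
        by (rule measurable_compose[OF measurable_component_singleton])
           (use borel_measurable_D_iff[THEN iffD1, OF borel_measurable_integrable[OF f]] in auto)
    qed
    have h_cong: "?h x = ?h y" if "\<And>i. i \<in> {1..Suc j + m} \<Longrightarrow> x i = y i" for x y
    proof -
      have "x (Suc j) = y (Suc j)" by (rule that) simp
      moreover have "conj_chain x A (Suc j + m) = conj_chain y A (Suc j + m)"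
        by (rule conj_chain_cong) (rule that)
      ultimately show ?thesis by simp
    qed
    \<comment> \<open>The old weight is a scalar and moves inside the new conjugation, so it counts
      as part of the past.\<close>
    have eq: "f (T (Suc j) \<omega>) *\<^sub>R conj_chain (\<lambda>s. T s \<omega>) A (Suc j + Suc m)
        = 1 *\<^sub>R task_conj (T (Suc (Suc j + m)) \<omega>) (?h (\<lambda>j. T j \<omega>))" for \<omega>
      by (simp add: linear_scale[OF linear_task_conj])
    have one: "integrable D (\<lambda>_. 1::real)" by simp
    have "?int (Suc m)"
      unfolding eq by (rule integrable_step[OF one h h_cong]) (use Suc in auto)
    moreover have "?eq (Suc m)"
      unfolding eq by (subst integral_step[OF one h h_cong]) (use Suc in \<open>auto simp: S_op_def[symmetric]\<close>)
    ultimately show ?case by blast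
  qed
  then show "?int m" "?eq m" by auto
qed

text \<open>The matrix \<open>C\<close> is not a scalar weight, so each of its entries is used as
  one. The sum over the entries restores the Frobenius product, and self-adjointness carries
  \<open>S^m\<close> over to \<open>C\<close>.\<close>

lemma integrable_loss_chain:
    "integrable M (\<lambda>\<omega>. task_C (T (Suc j) \<omega>) \<bullet> conj_chain (\<lambda>s. T s \<omega>) A (Suc j + m))" (is ?int)
  and integral_loss_chain:
    "(\<integral>\<omega>. task_C (T (Suc j) \<omega>) \<bullet> conj_chain (\<lambda>s. T s \<omega>) A (Suc j + m) \<partial>M) = mean_loss m j A" (is ?eq)
proof -
  let ?B = "(S_op D ^^ j) A"
  define F where "F a b \<omega> = task_C (T (Suc j) \<omega>) $ a $ b *\<^sub>R conj_chain (\<lambda>s. T s \<omega>) A (Suc j + m)" for a b \<omega>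
  have C: "integrable D (\<lambda>\<tau>. task_C \<tau> $ a $ b)" for a b
    by (intro integrable_vec_nth integrable_task_C)
  have F: "integrable M (F a b)" for a b
    unfolding F_def by (rule integrable_weighted_conj_chain[OF C])
  have inner: "task_C (T (Suc j) \<omega>) \<bullet> conj_chain (\<lambda>s. T s \<omega>) A (Suc j + m) = (\<Sum>a\<in>UNIV. \<Sum>b\<in>UNIV. F a b \<omega> $ a $ b)" for \<omega>
    by (simp add: inner_vec_def F_def)
  show ?int
    unfolding inner by (intro Bochner_Integration.integrable_sum integrable_vec_nth F)
  have CB: "integrable D (\<lambda>\<tau>. task_C \<tau> $ a $ b *\<^sub>R task_conj \<tau> ?B)" for a b
    by (rule integrable_task_conj[OF C borel_measurable_const order.refl])
  have S: "integrable D (\<lambda>\<tau>. (S_op D ^^ m) (task_C \<tau> $ a $ b *\<^sub>R task_conj \<tau> ?B))" for a b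
    by (rule integrable_bounded_linear[OF bounded_linear_S_pow CB])
  have "(\<integral>\<omega>. task_C (T (Suc j) \<omega>) \<bullet> conj_chain (\<lambda>s. T s \<omega>) A (Suc j + m) \<partial>M)
      = (\<Sum>a\<in>UNIV. \<Sum>b\<in>UNIV. (\<integral>\<omega>. F a b \<omega> \<partial>M) $ a $ b)"
    unfolding inner
    by (simp add: Bochner_Integration.integral_sum Bochner_Integration.integrable_sum integrable_vec_nth F integral_vec_nth)
  also have "\<dots> = (\<Sum>a\<in>UNIV. \<Sum>b\<in>UNIV. (\<integral>\<tau>. (S_op D ^^ m) (task_C \<tau> $ a $ b *\<^sub>R task_conj \<tau> ?B) \<partial>D) $ a $ b)"
    unfolding F_def integral_weighted_conj_chain[OF C] integral_bounded_linear[OF bounded_linear_S_pow CB] ..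
  also have "\<dots> = (\<integral>\<tau>. (\<Sum>a\<in>UNIV. \<Sum>b\<in>UNIV. (S_op D ^^ m) (task_C \<tau> $ a $ b *\<^sub>R task_conj \<tau> ?B) $ a $ b) \<partial>D)"
    by (simp add: Bochner_Integration.integral_sum Bochner_Integration.integrable_sum integrable_vec_nth S integral_vec_nth)
  also have "\<dots> = (\<integral>\<tau>. task_C \<tau> \<bullet> (S_op D ^^ m) (task_conj \<tau> ?B) \<partial>D)"
    by (simp add: linear_scale[OF linear_funpow[OF linear_S_op]] inner_vec_def)
  also have "\<dots> = mean_loss m j A"
    by (simp add: mean_loss_def inner_S_pow)
  finally show ?eq .
qed

text \<open>There are countably many tasks, so almost surely \<open>w\<close> solves all of them at
  once, and then each loss is a Frobenius product of \<open>C\<close> with the full chain. The index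
  \<open>j\<close> stands for \<open>t - 1\<close>.\<close>

lemma forgetting_eq_mean_loss:
  assumes "AE \<tau> in D. solves \<tau> w"
  shows "forgetting M T k = 1 / real k * (\<Sum>j<k. mean_loss (k - Suc j) j (outer_self w))"
proof -
  let ?L = "\<lambda>j \<omega>. task_C (T (Suc j) \<omega>) \<bullet> conj_chain (\<lambda>s. T s \<omega>) (outer_self w) k"
  have AE_t: "AE \<omega> in M. solves (T t \<omega>) w" if "t \<ge> 1" for t
    by (rule AE_distrD[OF measurable_T[OF that]]) (simp only: distr_T[OF that] assms)
  have "AE \<omega> in M. \<forall>t\<in>{1..}. solves (T t \<omega>) w"
    using AE_t by (subst AE_ball_countable) auto
  then have eq: "AE \<omega> in M. 1 / real k * (\<Sum>t=1..k. task_loss (T t \<omega>) (iterate (\<lambda>s. T s \<omega>) k))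
     = 1 / real k * (\<Sum>j<k. ?L j \<omega>)"
  proof eventually_elim
    case (elim \<omega>)
    then have "task_loss (T (Suc j) \<omega>) (iterate (\<lambda>s. T s \<omega>) k) = ?L j \<omega>" for j
      by (subst task_loss_solves[of _ w]) (simp_all add: conj_chain_outer_self)
    then show ?case
      by (simp add: sum.atLeast1_atMost_eq)
  qed
  have L: "integrable M (?L j)" "(\<integral>\<omega>. ?L j \<omega> \<partial>M) = mean_loss (k - Suc j) j (outer_self w)" if "j < k" for j
    using that integrable_loss_chain[where j = j and A = "outer_self w" and m = "k - Suc j"]
      integral_loss_chain[where j = j and A = "outer_self w" and m = "k - Suc j"]
    by simp_all
  have "forgetting M T k = (\<integral>\<omega>. 1 / real k * (\<Sum>j<k. ?L j \<omega>) \<partial>M)"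
    unfolding forgetting_def
  proof (rule integral_cong_AE[OF _ _ eq])
    show "(\<lambda>\<omega>. 1 / real k * (\<Sum>t=1..k. task_loss (T t \<omega>) (iterate (\<lambda>s. T s \<omega>) k))) \<in> borel_measurable M"
      by (intro borel_measurable_times borel_measurable_const borel_measurable_sum borel_measurable_task_loss
          borel_measurable_iterate measurable_T) auto
    show "(\<lambda>\<omega>. 1 / real k * (\<Sum>j<k. ?L j \<omega>)) \<in> borel_measurable M"
      by (intro borel_measurable_times borel_measurable_const borel_measurable_sum borel_measurable_integrable L) auto
  qed
  also have "\<dots> = 1 / real k * (\<Sum>j<k. mean_loss (k - Suc j) j (outer_self w))"
    by (simp add: Bochner_Integration.integral_sum L)
  finally show ?thesis .
qed

end

section \<open>Summing the errors over the tasks\<close>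

lemma sum_powers_le:
  fixes p q :: real
  assumes "0 \<le> q" "q < p"
  shows "(\<Sum>j<k. q ^ (k - Suc j) * p ^ j + p ^ (k - Suc j) * q ^ j) \<le> 2 * p ^ k / (p - q)"
proof -
  \<comment> \<open>Both geometric sums equal \<open>(p^k - q^k) / (p - q)\<close>, and
    \<open>q^k\<close> is then dropped.\<close>
  have "p ^ k - q ^ k = (p - q) * (\<Sum>j<k. q ^ (k - Suc j) * p ^ j)"
    by (rule power_diff_sumr2)
  moreover have "p ^ k - q ^ k = (p - q) * (\<Sum>j<k. p ^ (k - Suc j) * q ^ j)"
    using power_diff_sumr2[of q k p] by (simp only: left_diff_distrib)
  ultimately have "(p - q) * (\<Sum>j<k. q ^ (k - Suc j) * p ^ j + p ^ (k - Suc j) * q ^ j) = 2 * (p ^ k - q ^ k)"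
    by (simp only: sum.distrib distrib_left)
  also have "\<dots> \<le> 2 * p ^ k" using assms by simp
  finally show ?thesis using assms by (simp add: field_simps)
qed

theorem theorem4p1:
  fixes M :: "'w measure"
    and D :: "('d::finite) task measure"
    and T :: "nat \<Rightarrow> 'w \<Rightarrow> 'd task"
    and wstar :: "real ^ 'd"
  assumes "prob_space D" and "sets D = sets task_space"
    and "AE \<tau> in D. solves \<tau> wstar"
    and "prob_space M"
    and "prob_space.indep_vars M (\<lambda>_. task_space) T {1..}"
    and "\<And>t. t \<ge> 1 \<Longrightarrow> distr M task_space (T t) = D"
    and "integrable D task_C"
    and "eta D < rho D"
  shows "(\<lambda>k. forgetting M T k - c_top D wstar * rho D ^ (k - 1))
           \<in> O(\<lambda>k. rho D ^ (k - 1) / real k + eta D ^ (k - 1))"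
proof -
  interpret D: prob_space D by fact
  interpret M: prob_space M by fact
  interpret iid_tasks D M T
    by unfold_locales (use assms in auto)
  define K where "K = (\<integral>\<tau>. norm (task_C \<tau>) \<partial>D) * norm (outer_self wstar)"
  have K: "K \<ge> 0" by (simp add: K_def)
  \<comment> \<open>\<open>K\<close> is the factor in \<open>mean_loss_bound\<close>. The rest comes
    from \<open>sum_powers_le\<close>, with one \<open>rho D\<close> split off from
    \<open>rho D ^ k\<close> to leave the exponent \<open>k - 1\<close>.\<close>
  let ?c = "K * (2 * rho D / (rho D - eta D))"
  have bound: "norm (forgetting M T k - c_top D wstar * rho D ^ (k - 1))
      \<le> ?c * norm (rho D ^ (k - 1) / real k + eta D ^ (k - 1))" if k: "k \<ge> 1" for k
  proof -
    let ?m = "\<lambda>j. mean_loss (k - Suc j) j (outer_self wstar) - c_top D wstar * rho D ^ (k - 1)"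
    \<comment> \<open>The leading term is the same for all \<open>k\<close> tasks, since the
      exponents \<open>k - Suc j\<close> and \<open>j\<close> always add up to \<open>k - 1\<close>;
      so it may be subtracted inside the average.\<close>
    have "forgetting M T k - c_top D wstar * rho D ^ (k - 1) = (\<Sum>j<k. ?m j) / real k"
      using k by (simp add: forgetting_eq_mean_loss[OF assms(3)] sum_subtractf diff_divide_distrib)
    moreover have "\<bar>\<Sum>j<k. ?m j\<bar> \<le> ?c * rho D ^ (k - 1)"
    proof -
      have "\<bar>\<Sum>j<k. ?m j\<bar> \<le> (\<Sum>j<k. \<bar>?m j\<bar>)" by (rule sum_abs)
      also have "\<dots> \<le> (\<Sum>j<k. K * (eta D ^ (k - Suc j) * rho D ^ j + rho D ^ (k - Suc j) * eta D ^ j))"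
      proof (rule sum_mono)
        fix j assume "j \<in> {..<k}"
        then have "k - Suc j + j = k - 1" by simp
        then show "\<bar>?m j\<bar> \<le> K * (eta D ^ (k - Suc j) * rho D ^ j + rho D ^ (k - Suc j) * eta D ^ j)"
          using mean_loss_bound[of "k - Suc j" j wstar] by (simp add: K_def)
      qed
      also have "\<dots> \<le> K * (2 * rho D ^ k / (rho D - eta D))"
        unfolding sum_distrib_left[symmetric]
        by (intro mult_left_mono K sum_powers_le eta_nonneg assms(8))
      also have "\<dots> = ?c * rho D ^ (k - 1)"
        using k by (simp add: power_eq_if)
      finally show ?thesis .
    qed
    ultimately have "norm (forgetting M T k - c_top D wstar * rho D ^ (k - 1)) \<le> ?c * rho D ^ (k - 1) / real k"
      by (simp only: real_norm_def abs_divide abs_of_nat divide_right_mono of_nat_0_le_iff)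
    then have "norm (forgetting M T k - c_top D wstar * rho D ^ (k - 1)) \<le> ?c * (rho D ^ (k - 1) / real k)"
      by (simp only: times_divide_eq_right)
    \<comment> \<open>Adding the nonnegative power of \<open>eta D\<close> only enlarges the right
      side, and \<open>?c\<close> is nonnegative.\<close>
    also have "\<dots> \<le> ?c * norm (rho D ^ (k - 1) / real k + eta D ^ (k - 1))"
      using K rho_nonneg eta_nonneg assms(8) by (intro mult_left_mono) auto
    finally show ?thesis .
  qed
  then show ?thesis
    by (intro bigoI eventually_at_top_linorderI)
qed

end
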